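(* The following are provable in $\mathsf{ZF}$ (no choice): (1) $\mathsf{EDM}({\nless}\aleph_0,{=}|V|)$ is equivalent to $\mathsf{EDM}({\geq}\aleph_0,{=}|V|)$. (2) $\mathsf{EDM}({\geq}\aleph_0,{\nleq}\aleph_0)$ is equivalent to each of $\mathsf{EDM}({\geq}\aleph_0,{>}\aleph_0)$ and $\mathsf{EDM}({\nless}\aleph_0,{>}\aleph_0)$. (3) $\mathsf{EDM}({\nless}\aleph_0,{=}|V|)\Rightarrow\mathsf{EDM}({\nless}\aleph_0,{>}\aleph_0)\Rightarrow\mathsf{EDM}({\nless}\aleph_0,{\nleq}\aleph_0)$.
   Context: Work in $\mathsf{ZF}$ without choice. For sets, $|X|\le|Y|$ means there is an injection $X\to Y$, $|X|=|Y|$ means there is a bijection, and $|X|<|Y|$ (equivalently $|Y|>|X|$) means $|X|\le|Y|$ and $|X|\ne|Y|$. So $|X|\nless\aleph_0$ means $X$ is infinite (not finite); $|X|\ge\aleph_0$ means $X$ has a countably infinite subset; $|X|\nleq\aleph_0$ means $X$ is uncountable (not countable); $|X|>\aleph_0$ means $X$ is uncountable and has a countably infinite subset. A graph $G=(V,E)$ is a set $V$ with a set $E$ of unordered pairs of distinct elements of $V$; $I\subseteq V$ is independent if no pair of distinct elements of $I$ is in $E$; a subgraph $(V',E')$ has $V'\subseteq V$, $E'\subseteq E$; it is a clique if any two distinct elements of $V'$ form an edge in $E'$. For $B$ one of ${\nless}\aleph_0$, ${\ge}\aleph_0$ and $C$ one of ${\nleq}\aleph_0$, ${>}\aleph_0$,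 ${=}|V|$, $\mathsf{EDM}(B,C)$ is the statement: for every graph $G=(V,E)$ with $|V|\nleq\aleph_0$, either $V$ contains an independent set $I$ whose cardinality $|I|$ satisfies $B$, or $G$ has a subgraph $G'=(V',E')$ which is a clique and whose vertex set's cardinality $|V'|$ satisfies $C$. *)

theory Defs
  imports Main
begin

text \<open>
  Isabelle/HOL validates the axiom of choice, so ``provable in ZF'' is rendered literally: a deep
  embedding of the first-order language of set theory, a classical deduction calculus for it, the
  axioms of ZF (without choice), and the statements EDM(B,C) as sentences of that language.
\<close>

section \<open>First-order logic with equality over one binary relation symbol\<close>

text \<open>Variables are de Bruijn indices and are the only terms.\<close>

datatype fm =
    Eq nat nat
  | Mem nat nat
  | Bot
  | Imp fm fm
  | All fm

text \<open>As variables are the only terms, substitution is renaming of the free variables.\<close>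

primrec ren :: "(nat \<Rightarrow> nat) \<Rightarrow> fm \<Rightarrow> fm" where
  "ren r (Eq i j) = Eq (r i) (r j)"
| "ren r (Mem i j) = Mem (r i) (r j)"
| "ren r Bot = Bot"
| "ren r (Imp \<phi> \<psi>) = Imp (ren r \<phi>) (ren r \<psi>)"
| "ren r (All \<phi>) = All (ren (case_nat 0 (\<lambda>i. Suc (r i))) \<phi>)"

definition shift :: "fm \<Rightarrow> fm" where
  "shift \<phi> = ren Suc \<phi>"

text \<open>Replace the variable bound by an outermost quantifier, now free, by the variable \<open>t\<close>.\<close>

definition inst :: "nat \<Rightarrow> fm \<Rightarrow> fm" where
  "inst t \<phi> = ren (case_nat t (\<lambda>i. i)) \<phi>"

text \<open>
  Classical natural deduction. The eigenvariable condition of \<open>AllI\<close> is expressed by shifting the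
  context, so that variable 0 does not occur free in it.
\<close>

inductive proves :: "fm set \<Rightarrow> fm \<Rightarrow> bool" (infix "\<turnstile>" 50) where
  Assm: "\<phi> \<in> \<Gamma> \<Longrightarrow> \<Gamma> \<turnstile> \<phi>"
| ImpI: "insert \<phi> \<Gamma> \<turnstile> \<psi> \<Longrightarrow> \<Gamma> \<turnstile> Imp \<phi> \<psi>"
| ImpE: "\<Gamma> \<turnstile> Imp \<phi> \<psi> \<Longrightarrow> \<Gamma> \<turnstile> \<phi> \<Longrightarrow> \<Gamma> \<turnstile> \<psi>"
| Classical: "insert (Imp \<phi> Bot) \<Gamma> \<turnstile> Bot \<Longrightarrow> \<Gamma> \<turnstile> \<phi>"
| AllI: "shift ` \<Gamma> \<turnstile> \<phi> \<Longrightarrow> \<Gamma> \<turnstile> All \<phi>"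
| AllE: "\<Gamma> \<turnstile> All \<phi> \<Longrightarrow> \<Gamma> \<turnstile> inst t \<phi>"
| EqI: "\<Gamma> \<turnstile> Eq i i"
| EqE: "\<Gamma> \<turnstile> Eq i j \<Longrightarrow> \<Gamma> \<turnstile> inst i \<phi> \<Longrightarrow> \<Gamma> \<turnstile> inst j \<phi>"

text \<open>All free variables are below \<open>n\<close>.\<close>

primrec fv_below :: "nat \<Rightarrow> fm \<Rightarrow> bool" where
  "fv_below n (Eq i j) \<longleftrightarrow> i < n \<and> j < n"
| "fv_below n (Mem i j) \<longleftrightarrow> i < n \<and> j < n"
| "fv_below n Bot \<longleftrightarrow> True"
| "fv_below n (Imp \<phi> \<psi>) \<longleftrightarrow> fv_below n \<phi> \<and> fv_below n \<psi>"
| "fv_below n (All \<phi>) \<longleftrightarrow> fv_below (Suc n) \<phi>"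


section \<open>Readable formulas\<close>

text \<open>
  To write formulas with named variables, an expression of type \<open>form\<close> maps the number \<open>d\<close> of
  enclosing quantifiers to a formula. Here a variable is denoted by its level, the number of
  quantifiers enclosing its binder, so that below \<open>d\<close> quantifiers the level \<open>x < d\<close> has de Bruijn
  index \<open>d - Suc x\<close>. A quantifier passes the level of its variable to its body; a form \<open>p\<close> all of
  whose variables are bound in this way denotes the sentence \<open>p 0\<close>.
\<close>

type_synonym form = "nat \<Rightarrow> fm"

definition feq :: "nat \<Rightarrow> nat \<Rightarrow> form" (infix "\<^bold>=" 50) where
  "(x \<^bold>= y) = (\<lambda>d. Eq (d - Suc x) (d - Suc y))"

definition fmem :: "nat \<Rightarrow> nat \<Rightarrow> form" (infix "\<^bold>\<in>" 50) where
  "(x \<^bold>\<in> y) = (\<lambda>d. Mem (d - Suc x) (d - Suc y))"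

definition fimp :: "form \<Rightarrow> form \<Rightarrow> form" (infixr "\<^bold>\<longrightarrow>" 25) where
  "(p \<^bold>\<longrightarrow> q) = (\<lambda>d. Imp (p d) (q d))"

definition fnot :: "form \<Rightarrow> form" ("\<^bold>\<not> _" [40] 40) where
  "(\<^bold>\<not> p) = (p \<^bold>\<longrightarrow> (\<lambda>d. Bot))"

definition fand :: "form \<Rightarrow> form \<Rightarrow> form" (infixr "\<^bold>\<and>" 35) where
  "(p \<^bold>\<and> q) = (\<^bold>\<not> (p \<^bold>\<longrightarrow> \<^bold>\<not> q))"

definition f_or :: "form \<Rightarrow> form \<Rightarrow> form" (infixr "\<^bold>\<or>" 30) where
  "(p \<^bold>\<or> q) = (\<^bold>\<not> p \<^bold>\<longrightarrow> q)"

definition fiff :: "form \<Rightarrow> form \<Rightarrow> form" (infixr "\<^bold>\<longleftrightarrow>" 25) where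
  "(p \<^bold>\<longleftrightarrow> q) = ((p \<^bold>\<longrightarrow> q) \<^bold>\<and> (q \<^bold>\<longrightarrow> p))"

definition fall :: "(nat \<Rightarrow> form) \<Rightarrow> form" (binder "\<^bold>\<forall>" 10) where
  "fall P = (\<lambda>d. All (P d (Suc d)))"

definition fex :: "(nat \<Rightarrow> form) \<Rightarrow> form" (binder "\<^bold>\<exists>" 10) where
  "fex P = (\<^bold>\<not> (\<^bold>\<forall>x. \<^bold>\<not> P x))"

text \<open>The formula \<open>\<phi>\<close> with each free variable \<open>i\<close> replaced by the variable of level \<open>e i\<close>.\<close>

definition holds :: "fm \<Rightarrow> (nat \<Rightarrow> nat) \<Rightarrow> form" where
  "holds \<phi> e = (\<lambda>d. ren (\<lambda>i. d - Suc (e i)) \<phi>)"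

text \<open>Universal quantification over \<open>k\<close> parameters, which in \<open>p\<close> have the levels \<open>0, \<dots>, k - 1\<close>.\<close>

definition univ_closure :: "nat \<Rightarrow> form \<Rightarrow> fm" where
  "univ_closure k p = (All ^^ k) (p k)"


section \<open>The axioms of ZF\<close>

definition is_subset :: "nat \<Rightarrow> nat \<Rightarrow> form" (infix "\<^bold>\<subseteq>" 50) where
  "(x \<^bold>\<subseteq> y) = (\<^bold>\<forall>z. z \<^bold>\<in> x \<^bold>\<longrightarrow> z \<^bold>\<in> y)"

definition is_empty :: "nat \<Rightarrow> form" where
  "is_empty x = (\<^bold>\<forall>z. \<^bold>\<not> z \<^bold>\<in> x)"

text \<open>\<open>y = x \<union> {x}\<close>\<close>

definition is_succ :: "nat \<Rightarrow> nat \<Rightarrow> form" where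
  "is_succ y x = (\<^bold>\<forall>z. z \<^bold>\<in> y \<^bold>\<longleftrightarrow> z \<^bold>\<in> x \<^bold>\<or> z \<^bold>= x)"

definition is_inductive :: "nat \<Rightarrow> form" where
  "is_inductive w =
    ((\<^bold>\<exists>x. is_empty x \<^bold>\<and> x \<^bold>\<in> w) \<^bold>\<and>
     (\<^bold>\<forall>x. x \<^bold>\<in> w \<^bold>\<longrightarrow> (\<^bold>\<exists>y. is_succ y x \<^bold>\<and> y \<^bold>\<in> w)))"

definition extensionality :: form where
  "extensionality = (\<^bold>\<forall>x. \<^bold>\<forall>y. (\<^bold>\<forall>z. z \<^bold>\<in> x \<^bold>\<longleftrightarrow> z \<^bold>\<in> y) \<^bold>\<longrightarrow> x \<^bold>= y)"

definition foundation :: form where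
  "foundation =
    (\<^bold>\<forall>x. (\<^bold>\<exists>y. y \<^bold>\<in> x) \<^bold>\<longrightarrow> (\<^bold>\<exists>y. y \<^bold>\<in> x \<^bold>\<and> \<^bold>\<not> (\<^bold>\<exists>z. z \<^bold>\<in> x \<^bold>\<and> z \<^bold>\<in> y)))"

definition pairing :: form where
  "pairing = (\<^bold>\<forall>x. \<^bold>\<forall>y. \<^bold>\<exists>u. \<^bold>\<forall>z. z \<^bold>\<in> u \<^bold>\<longleftrightarrow> z \<^bold>= x \<^bold>\<or> z \<^bold>= y)"

definition union_axiom :: form where
  "union_axiom = (\<^bold>\<forall>x. \<^bold>\<exists>u. \<^bold>\<forall>z. z \<^bold>\<in> u \<^bold>\<longleftrightarrow> (\<^bold>\<exists>y. y \<^bold>\<in> x \<^bold>\<and> z \<^bold>\<in> y))"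

definition power_set :: form where
  "power_set = (\<^bold>\<forall>x. \<^bold>\<exists>u. \<^bold>\<forall>z. z \<^bold>\<in> u \<^bold>\<longleftrightarrow> z \<^bold>\<subseteq> x)"

definition infinity :: form where
  "infinity = (\<^bold>\<exists>w. is_inductive w)"

text \<open>
  The formula \<open>\<phi>\<close> has \<open>x\<close> as variable 0; its other free variables \<open>1, \<dots>, k\<close> are parameters, of
  levels \<open>0, \<dots>, k - 1\<close>.
\<close>

definition separation :: "fm \<Rightarrow> form" where
  "separation \<phi> =
    (\<^bold>\<forall>a. \<^bold>\<exists>b. \<^bold>\<forall>x. x \<^bold>\<in> b \<^bold>\<longleftrightarrow> x \<^bold>\<in> a \<^bold>\<and> holds \<phi> (case_nat x (\<lambda>i. i)))"

text \<open>
  The formula \<open>\<phi>\<close> has \<open>x\<close>, \<open>y\<close> as variables 0, 1; its other free variables \<open>2, \<dots>, k + 1\<close> are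
  parameters, of levels \<open>0, \<dots>, k - 1\<close>.
\<close>

definition replacement :: "fm \<Rightarrow> form" where
  "replacement \<phi> =
    (let F = (\<lambda>x y. holds \<phi> (case_nat x (case_nat y (\<lambda>i. i)))) in
      \<^bold>\<forall>a. (\<^bold>\<forall>x. \<^bold>\<forall>y. \<^bold>\<forall>z. x \<^bold>\<in> a \<^bold>\<and> F x y \<^bold>\<and> F x z \<^bold>\<longrightarrow> y \<^bold>= z) \<^bold>\<longrightarrow>
           (\<^bold>\<exists>b. \<^bold>\<forall>y. y \<^bold>\<in> b \<^bold>\<longleftrightarrow> (\<^bold>\<exists>x. x \<^bold>\<in> a \<^bold>\<and> F x y)))"

definition ZF :: "fm set" where
  "ZF =
    {extensionality 0, foundation 0, pairing 0, union_axiom 0, power_set 0, infinity 0} \<union>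
    {univ_closure k (separation \<phi>) | k \<phi>. fv_below (Suc k) \<phi>} \<union>
    {univ_closure k (replacement \<phi>) | k \<phi>. fv_below (Suc (Suc k)) \<phi>}"


section \<open>Cardinalities\<close>

text \<open>\<open>u = {x, y}\<close>\<close>

definition is_upair :: "nat \<Rightarrow> nat \<Rightarrow> nat \<Rightarrow> form" where
  "is_upair u x y = (\<^bold>\<forall>z. z \<^bold>\<in> u \<^bold>\<longleftrightarrow> z \<^bold>= x \<^bold>\<or> z \<^bold>= y)"

text \<open>\<open>p = (x, y)\<close>, the Kuratowski pair \<open>{{x}, {x, y}}\<close>\<close>

definition is_opair :: "nat \<Rightarrow> nat \<Rightarrow> nat \<Rightarrow> form" where
  "is_opair p x y = (\<^bold>\<forall>u. u \<^bold>\<in> p \<^bold>\<longleftrightarrow> is_upair u x x \<^bold>\<or> is_upair u x y)"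

text \<open>\<open>(x, y) \<in> f\<close>\<close>

definition maps :: "nat \<Rightarrow> nat \<Rightarrow> nat \<Rightarrow> form" where
  "maps f x y = (\<^bold>\<exists>p. is_opair p x y \<^bold>\<and> p \<^bold>\<in> f)"

definition is_function :: "nat \<Rightarrow> nat \<Rightarrow> nat \<Rightarrow> form" where
  "is_function f X Y =
    ((\<^bold>\<forall>p. p \<^bold>\<in> f \<^bold>\<longrightarrow> (\<^bold>\<exists>x. \<^bold>\<exists>y. x \<^bold>\<in> X \<^bold>\<and> y \<^bold>\<in> Y \<^bold>\<and> is_opair p x y)) \<^bold>\<and>
     (\<^bold>\<forall>x. x \<^bold>\<in> X \<^bold>\<longrightarrow> (\<^bold>\<exists>y. maps f x y \<^bold>\<and> (\<^bold>\<forall>z. maps f x z \<^bold>\<longrightarrow> z \<^bold>= y))))"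

definition is_injection :: "nat \<Rightarrow> nat \<Rightarrow> nat \<Rightarrow> form" where
  "is_injection f X Y =
    (is_function f X Y \<^bold>\<and>
     (\<^bold>\<forall>x. \<^bold>\<forall>x'. \<^bold>\<forall>y. maps f x y \<^bold>\<and> maps f x' y \<^bold>\<longrightarrow> x \<^bold>= x'))"

definition is_bijection :: "nat \<Rightarrow> nat \<Rightarrow> nat \<Rightarrow> form" where
  "is_bijection f X Y =
    (is_injection f X Y \<^bold>\<and> (\<^bold>\<forall>y. y \<^bold>\<in> Y \<^bold>\<longrightarrow> (\<^bold>\<exists>x. maps f x y)))"

definition card_le :: "nat \<Rightarrow> nat \<Rightarrow> form" where
  "card_le X Y = (\<^bold>\<exists>f. is_injection f X Y)"

definition card_eq :: "nat \<Rightarrow> nat \<Rightarrow> form" where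
  "card_eq X Y = (\<^bold>\<exists>f. is_bijection f X Y)"

definition card_less :: "nat \<Rightarrow> nat \<Rightarrow> form" where
  "card_less X Y = (card_le X Y \<^bold>\<and> \<^bold>\<not> card_eq X Y)"

definition is_omega :: "nat \<Rightarrow> form" where
  "is_omega w = (is_inductive w \<^bold>\<and> (\<^bold>\<forall>v. is_inductive v \<^bold>\<longrightarrow> w \<^bold>\<subseteq> v))"

definition nless_aleph0 :: "nat \<Rightarrow> form" where
  "nless_aleph0 X = (\<^bold>\<exists>w. is_omega w \<^bold>\<and> \<^bold>\<not> card_less X w)"

definition ge_aleph0 :: "nat \<Rightarrow> form" where
  "ge_aleph0 X = (\<^bold>\<exists>w. is_omega w \<^bold>\<and> card_le w X)"

definition nle_aleph0 :: "nat \<Rightarrow> form" where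
  "nle_aleph0 X = (\<^bold>\<exists>w. is_omega w \<^bold>\<and> \<^bold>\<not> card_le X w)"

definition gt_aleph0 :: "nat \<Rightarrow> form" where
  "gt_aleph0 X = (\<^bold>\<exists>w. is_omega w \<^bold>\<and> card_less w X)"


section \<open>Graphs and the statements EDM(B,C)\<close>

definition is_graph :: "nat \<Rightarrow> nat \<Rightarrow> form" where
  "is_graph V E =
    (\<^bold>\<forall>e. e \<^bold>\<in> E \<^bold>\<longrightarrow>
      (\<^bold>\<exists>x. \<^bold>\<exists>y. x \<^bold>\<in> V \<^bold>\<and> y \<^bold>\<in> V \<^bold>\<and> \<^bold>\<not> x \<^bold>= y \<^bold>\<and> is_upair e x y))"

text \<open>\<open>{x, y} \<in> E\<close>\<close>

definition adjacent :: "nat \<Rightarrow> nat \<Rightarrow> nat \<Rightarrow> form" where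
  "adjacent E x y = (\<^bold>\<exists>e. is_upair e x y \<^bold>\<and> e \<^bold>\<in> E)"

definition is_independent :: "nat \<Rightarrow> nat \<Rightarrow> nat \<Rightarrow> form" where
  "is_independent V E I =
    (I \<^bold>\<subseteq> V \<^bold>\<and>
     (\<^bold>\<forall>x. \<^bold>\<forall>y. x \<^bold>\<in> I \<^bold>\<and> y \<^bold>\<in> I \<^bold>\<and> \<^bold>\<not> x \<^bold>= y \<^bold>\<longrightarrow> \<^bold>\<not> adjacent E x y))"

definition is_subgraph :: "nat \<Rightarrow> nat \<Rightarrow> nat \<Rightarrow> nat \<Rightarrow> form" where
  "is_subgraph V' E' V E = (is_graph V' E' \<^bold>\<and> V' \<^bold>\<subseteq> V \<^bold>\<and> E' \<^bold>\<subseteq> E)"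

definition is_clique :: "nat \<Rightarrow> nat \<Rightarrow> form" where
  "is_clique V' E' =
    (\<^bold>\<forall>x. \<^bold>\<forall>y. x \<^bold>\<in> V' \<^bold>\<and> y \<^bold>\<in> V' \<^bold>\<and> \<^bold>\<not> x \<^bold>= y \<^bold>\<longrightarrow> adjacent E' x y)"

text \<open>
  \<open>B I\<close> is the condition on the cardinality of the independent set \<open>I\<close>; \<open>C V V'\<close> is the condition
  on the cardinality of the vertex set \<open>V'\<close> of the clique, which may refer to \<open>V\<close>.
\<close>

definition EDM :: "(nat \<Rightarrow> form) \<Rightarrow> (nat \<Rightarrow> nat \<Rightarrow> form) \<Rightarrow> form" where
  "EDM B C =
    (\<^bold>\<forall>V. \<^bold>\<forall>E. is_graph V E \<^bold>\<and> nle_aleph0 V \<^bold>\<longrightarrow>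
      (\<^bold>\<exists>I. is_independent V E I \<^bold>\<and> B I) \<^bold>\<or>
      (\<^bold>\<exists>V'. \<^bold>\<exists>E'. is_subgraph V' E' V E \<^bold>\<and> is_clique V' E' \<^bold>\<and> C V V'))"


definition C_nle :: "nat \<Rightarrow> nat \<Rightarrow> form" where
  "C_nle V V' = nle_aleph0 V'"

definition C_gt :: "nat \<Rightarrow> nat \<Rightarrow> form" where
  "C_gt V V' = gt_aleph0 V'"

definition C_eqV :: "nat \<Rightarrow> nat \<Rightarrow> form" where
  "C_eqV V V' = card_eq V' V"

definition ZF_proves :: "form \<Rightarrow> bool" where
  "ZF_proves p \<longleftrightarrow> (ZF \<turnstile> p 0)"

end

theory Submission
  imports Defs "HOL-Library.Countable" "HOL-Library.Infinite_Set"
begin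

text \<open>
  By the completeness theorem it suffices to verify the implications in every model of ZF, and as
  models of ZF are infinite, models on the natural numbers are enough. Inside a model, the point is
  that each of the strong versions implies that every uncountable set has a countably infinite
  subset; then ``infinite'' and ``at least $\aleph_0$'' coincide, and so do ``uncountable'' and
  ``above $\aleph_0$''. For independent sets of size at least $\aleph_0$ this is seen from graphs
  without edges. For infinite independent sets, one applies the statement to the complete graph
  minus one edge: independent sets have at most two elements and every clique omits a vertex, so a
  clique equinumerous with the vertex set makes the latter Dedekind-infinite.
\<close>

section \<open>Syntax and derivations\<close>

text \<open>Choice holds in the metatheory, so a HOL injection between the extensions of two sets
  need not be an element of the model. Every map is therefore kept definable with parameters
  (\<open>fun_definable\<close>), and separation inside a suitable power set turns it back into an
  element. As \<open>definable\<close> predicates are closed under connectives and quantifiers,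
  formulas rarely have to be written out. The price is that inverses and iterates need an explicit
  definable description.

  If every uncountable set contains a copy of omega, then an infinite set does so as well: it is
  uncountable, or it is countable and hence equinumerous with omega. An uncountable set containing
  omega is never equinumerous with it. The converse directions rest on Cantor-Bernstein, which needs
  no choice.

  In the Henkin argument variables act as the new constants: the theory consists of sentences and
  each stage adds finitely many formulas, so a fresh variable is always at hand without extending
  the language.\<close>

abbreviation lift_ren :: "(nat \<Rightarrow> nat) \<Rightarrow> nat \<Rightarrow> nat" where
  "lift_ren r \<equiv> case_nat 0 (\<lambda>i. Suc (r i))"

abbreviation Neg :: "fm \<Rightarrow> fm" where
  "Neg \<phi> \<equiv> Imp \<phi> Bot"

lemma ren_ren: "ren r (ren s \<phi>) = ren (r \<circ> s) \<phi>"
proof (induction \<phi> arbitrary: r s)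
  case (All \<phi>)
  have "lift_ren r \<circ> lift_ren s = lift_ren (r \<circ> s)"
    by (auto simp: fun_eq_iff split: nat.split)
  with All show ?case by (simp add: comp_def)
qed auto

lemma ren_cong:
  "fv_below n \<phi> \<Longrightarrow> (\<And>i. i < n \<Longrightarrow> r i = s i) \<Longrightarrow> ren r \<phi> = ren s \<phi>"
proof (induction \<phi> arbitrary: n r s)
  case (All \<phi>)
  have "ren (lift_ren r) \<phi> = ren (lift_ren s) \<phi>"
    by (rule All.IH[of "Suc n"]) (use All.prems in \<open>auto split: nat.split\<close>)
  then show ?case by simp
next
  case (Imp \<phi> \<psi>)
  from Imp.IH(1)[of n r s] Imp.IH(2)[of n r s] Imp.prems show ?case by simp
qed auto

lemma ren_ident: "ren (\<lambda>i. i) \<phi> = \<phi>"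
proof (induction \<phi>)
  case (All \<phi>)
  have "lift_ren (\<lambda>i. i) = (\<lambda>i. i)" by (auto simp: fun_eq_iff split: nat.split)
  with All show ?case by simp
qed auto

lemma fv_below_mono: "fv_below m \<phi> \<Longrightarrow> m \<le> n \<Longrightarrow> fv_below n \<phi>"
proof (induction \<phi> arbitrary: m n)
  case (All \<phi>)
  from All.IH[of "Suc m" "Suc n"] All.prems show ?case by auto
qed auto

lemma fv_below_exists: "\<exists>n. fv_below n \<phi>"
proof (induction \<phi>)
  case (Eq i j)
  show ?case by (rule exI[of _ "Suc (i + j)"]) auto
next
  case (Mem i j)
  show ?case by (rule exI[of _ "Suc (i + j)"]) auto
next
  case (Imp \<phi> \<psi>)
  then obtain m n where "fv_below m \<phi>" "fv_below n \<psi>" by auto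
  then show ?case
    by (intro exI[of _ "max m n"]) (auto elim: fv_below_mono)
next
  case (All \<phi>)
  then obtain n where "fv_below n \<phi>" by auto
  then show ?case by (intro exI[of _ n]) (auto elim: fv_below_mono)
qed auto

lemma fv_below_ren: "(\<And>i. r i < n) \<Longrightarrow> fv_below n (ren r \<phi>)"
proof (induction \<phi> arbitrary: r n)
  case (All \<phi>)
  have "fv_below (Suc n) (ren (lift_ren r) \<phi>)"
    by (rule All.IH) (use All.prems in \<open>auto split: nat.split\<close>)
  then show ?case by simp
qed auto

lemma inst_ren: "ren r (inst t \<phi>) = inst (r t) (ren (lift_ren r) \<phi>)"
  unfolding inst_def ren_ren
  by (rule arg_cong[where f = "\<lambda>r. ren r \<phi>"]) (auto simp: fun_eq_iff split: nat.split)

lemma proves_mono: "\<Gamma> \<turnstile> \<phi> \<Longrightarrow> \<Gamma> \<subseteq> \<Delta> \<Longrightarrow> \<Delta> \<turnstile> \<phi>"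
proof (induction arbitrary: \<Delta> rule: proves.induct)
  case (ImpI \<phi> \<Gamma> \<psi>)
  then show ?case by (meson insert_mono proves.ImpI)
next
  case (Classical \<phi> \<Gamma>)
  then show ?case by (meson insert_mono proves.Classical)
next
  case (AllI \<Gamma> \<phi>)
  then show ?case by (meson image_mono proves.AllI)
next
  case (ImpE \<Gamma> \<phi> \<psi>)
  then show ?case by (meson proves.ImpE)
next
  case (EqE \<Gamma> i j \<phi>)
  then show ?case by (meson proves.EqE)
qed (auto simp: proves.Assm proves.AllE proves.EqI subset_iff)

text \<open>Holds for renamings that need not be injective: \<open>lift_ren r\<close> after
  \<open>Suc\<close> equals \<open>Suc\<close> after \<open>r\<close>, which carries the shifted
  context of \<open>AllI\<close> to the shifted renamed context. It serves to turn a Henkin variable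
  into a bound index.\<close>

lemma proves_ren: "\<Gamma> \<turnstile> \<phi> \<Longrightarrow> ren r ` \<Gamma> \<turnstile> ren r \<phi>"
proof (induction arbitrary: r rule: proves.induct)
  case (ImpI \<phi> \<Gamma> \<psi>)
  show ?case using proves.ImpI ImpI.IH[of r] by simp
next
  case (ImpE \<Gamma> \<phi> \<psi>)
  then show ?case by (metis proves.ImpE ren.simps(4))
next
  case (Classical \<phi> \<Gamma>)
  show ?case using Classical.IH[of r] by (simp add: proves.Classical)
next
  case (AllI \<Gamma> \<phi>)
  have "ren (lift_ren r) ` shift ` \<Gamma> = shift ` ren r ` \<Gamma>"
    by (simp add: image_image shift_def ren_ren comp_def)
  then show ?case using AllI.IH[of "lift_ren r"] by (simp add: proves.AllI)
next
  case (AllE \<Gamma> \<phi> t)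
  then show ?case unfolding inst_ren by (simp add: proves.AllE)
next
  case (EqE \<Gamma> i j \<phi>)
  then show ?case unfolding inst_ren by (metis proves.EqE ren.simps(1))
qed (auto simp: proves.Assm proves.EqI)

text \<open>Derivations are finite; this carries consistency from the Henkin stages to their
  union.\<close>

lemma proves_finite: "\<Gamma> \<turnstile> \<phi> \<Longrightarrow> \<exists>F. finite F \<and> F \<subseteq> \<Gamma> \<and> F \<turnstile> \<phi>"
proof (induction rule: proves.induct)
  case (Assm \<phi> \<Gamma>)
  then show ?case by (intro exI[of _ "{\<phi>}"]) (simp add: proves.Assm)
next
  case (ImpI \<phi> \<Gamma> \<psi>)
  then obtain F where F: "finite F" "F \<subseteq> insert \<phi> \<Gamma>" "F \<turnstile> \<psi>" by auto
  have "insert \<phi> (F - {\<phi>}) \<turnstile> \<psi>" by (rule proves_mono[OF F(3)]) auto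
  then have "F - {\<phi>} \<turnstile> Imp \<phi> \<psi>" by (rule proves.ImpI)
  with F(1,2) show ?case by (intro exI[of _ "F - {\<phi>}"]) auto
next
  case (ImpE \<Gamma> \<phi> \<psi>)
  then obtain F G where F: "finite F" "F \<subseteq> \<Gamma>" "F \<turnstile> Imp \<phi> \<psi>"
    and G: "finite G" "G \<subseteq> \<Gamma>" "G \<turnstile> \<phi>" by auto
  have "F \<union> G \<turnstile> \<psi>"
    by (rule proves.ImpE[of _ \<phi>]) (rule proves_mono[OF F(3)] proves_mono[OF G(3)], simp)+
  with F(1,2) G(1,2) show ?case by (intro exI[of _ "F \<union> G"]) simp
next
  case (Classical \<phi> \<Gamma>)
  then obtain F where F: "finite F" "F \<subseteq> insert (Neg \<phi>) \<Gamma>" "F \<turnstile> Bot" by auto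
  have "insert (Neg \<phi>) (F - {Neg \<phi>}) \<turnstile> Bot" by (rule proves_mono[OF F(3)]) auto
  then have "F - {Neg \<phi>} \<turnstile> \<phi>" by (rule proves.Classical)
  with F(1,2) show ?case by (intro exI[of _ "F - {Neg \<phi>}"]) auto
next
  case (AllI \<Gamma> \<phi>)
  then obtain F where F: "finite F" "F \<subseteq> shift ` \<Gamma>" "F \<turnstile> \<phi>" by auto
  then obtain G where "finite G" "G \<subseteq> \<Gamma>" "F = shift ` G" by (meson finite_subset_image)
  with F(3) show ?case using proves.AllI by blast
next
  case (AllE \<Gamma> \<phi> t)
  then show ?case using proves.AllE by blast
next
  case (EqI \<Gamma> i)
  show ?case using proves.EqI by blast
next
  case (EqE \<Gamma> i j \<phi>)
  then obtain F G where F: "finite F" "F \<subseteq> \<Gamma>" "F \<turnstile> Eq i j"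
    and G: "finite G" "G \<subseteq> \<Gamma>" "G \<turnstile> inst i \<phi>" by auto
  have "F \<union> G \<turnstile> inst j \<phi>"
    by (rule proves.EqE[of _ i]) (rule proves_mono[OF F(3)] proves_mono[OF G(3)], simp)+
  with F(1,2) G(1,2) show ?case by (intro exI[of _ "F \<union> G"]) simp
qed

section \<open>The completeness theorem\<close>

text \<open>The domain is a set rather than the whole type because the term model lives on chosen
  representatives among the variables.\<close>

primrec sat :: "'a set \<Rightarrow> ('a \<Rightarrow> 'a \<Rightarrow> bool) \<Rightarrow> (nat \<Rightarrow> 'a) \<Rightarrow> fm \<Rightarrow> bool" where
  "sat D M e (Eq i j) \<longleftrightarrow> e i = e j"
| "sat D M e (Mem i j) \<longleftrightarrow> M (e i) (e j)"
| "sat D M e Bot \<longleftrightarrow> False"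
| "sat D M e (Imp \<phi> \<psi>) \<longleftrightarrow> (sat D M e \<phi> \<longrightarrow> sat D M e \<psi>)"
| "sat D M e (All \<phi>) \<longleftrightarrow> (\<forall>a\<in>D. sat D M (case_nat a e) \<phi>)"

lemma sat_ren: "sat D M e (ren r \<phi>) \<longleftrightarrow> sat D M (\<lambda>i. e (r i)) \<phi>"
proof (induction \<phi> arbitrary: e r)
  case (All \<phi>)
  have "(\<lambda>i. case_nat a e (lift_ren r i)) = case_nat a (\<lambda>i. e (r i))" for a
    by (auto simp: fun_eq_iff split: nat.split)
  with All show ?case by simp
qed auto

lemma sat_cong:
  "fv_below n \<phi> \<Longrightarrow> (\<And>i. i < n \<Longrightarrow> e i = e' i) \<Longrightarrow> sat D M e \<phi> \<longleftrightarrow> sat D M e' \<phi>"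
proof (induction \<phi> arbitrary: n e e')
  case (All \<phi>)
  have "sat D M (case_nat a e) \<phi> \<longleftrightarrow> sat D M (case_nat a e') \<phi>" for a
    by (rule All.IH[of "Suc n"]) (use All.prems in \<open>auto split: nat.split\<close>)
  then show ?case by simp
next
  case (Imp \<phi> \<psi>)
  from Imp.IH(1)[of n e e'] Imp.IH(2)[of n e e'] Imp.prems show ?case by simp
qed auto

text \<open>Used to move a model from an infinite set of naturals to a whole type.\<close>

lemma sat_iso:
  assumes b: "bij_betw b UNIV D"
  shows "sat UNIV (\<lambda>x y. M (b x) (b y)) e \<phi> \<longleftrightarrow> sat D M (\<lambda>i. b (e i)) \<phi>"
proof (induction \<phi> arbitrary: e)
  case (Eq i j)
  from b show ?case by (auto simp: bij_betw_def inj_def)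
next
  case (All \<phi>)
  have "(\<lambda>i. b (case_nat a e i)) = case_nat (b a) (\<lambda>i. b (e i))" for a
    by (auto simp: fun_eq_iff split: nat.split)
  with All b show ?case by (auto simp: bij_betw_def)
qed auto

section \<open>Henkin construction\<close>

instance fm :: countable by countable_datatype

definition consistent :: "fm set \<Rightarrow> bool" where
  "consistent \<Gamma> \<longleftrightarrow> \<not> \<Gamma> \<turnstile> Bot"

text \<open>If the instance at a fresh \<open>t\<close> were derivable, renaming \<open>t\<close> to
  the bound index would yield the premise of \<open>AllI\<close>, hence \<open>All \<psi>\<close>,
  against its negation in the context.\<close>

lemma consistent_witness:
  assumes cons: "consistent (insert (Neg (All \<psi>)) \<Delta>)"
    and fresh: "\<And>\<chi>. \<chi> \<in> \<Delta> \<Longrightarrow> fv_below t \<chi>" "fv_below t (All \<psi>)"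
  shows "consistent (insert (Neg (inst t \<psi>)) (insert (Neg (All \<psi>)) \<Delta>))"
proof (rule ccontr)
  \<comment> \<open>The renaming \<open>?r\<close> agrees with \<open>Suc\<close> below
    \<open>t\<close>, so it shifts the context, while it sends \<open>t\<close> to the index that
    \<open>AllI\<close> binds.\<close>
  let ?\<Delta> = "insert (Neg (All \<psi>)) \<Delta>"
  let ?r = "\<lambda>i. if i = t then 0 else Suc i"
  assume "\<not> ?thesis"
  then have "?\<Delta> \<turnstile> inst t \<psi>" unfolding consistent_def by (meson Classical)
  then have *: "ren ?r ` ?\<Delta> \<turnstile> ren ?r (inst t \<psi>)" by (rule proves_ren)
  have "ren ?r \<chi> = shift \<chi>" if "\<chi> \<in> ?\<Delta>" for \<chi>
    unfolding shift_def by (rule ren_cong[of t]) (use that fresh in auto)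
  then have 1: "ren ?r ` ?\<Delta> = shift ` ?\<Delta>" by (intro image_cong) auto
  have "ren ?r (inst t \<psi>) = ren (\<lambda>i. i) \<psi>"
    unfolding inst_def ren_ren
    by (rule ren_cong[of "Suc t"]) (use fresh in \<open>auto split: nat.split\<close>)
  with * 1 have "shift ` ?\<Delta> \<turnstile> \<psi>" by (simp add: ren_ident)
  then have "?\<Delta> \<turnstile> All \<psi>" by (rule AllI)
  moreover have "?\<Delta> \<turnstile> Neg (All \<psi>)" by (rule Assm) auto
  ultimately show False using cons unfolding consistent_def by (meson ImpE)
qed

lemma fresh_exists:
  assumes "finite F" shows "\<exists>t. \<forall>\<chi>\<in>F. fv_below t \<chi>"
  using assms
proof (induction F)
  case (insert \<phi> F)
  then obtain m n where "\<forall>\<chi>\<in>F. fv_below m \<chi>" "fv_below n \<phi>" using fv_below_exists by blast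
  then show ?case by (intro exI[of _ "max m n"]) (metis fv_below_mono insert_iff max.cobounded1 max.cobounded2)
qed auto

text \<open>The witness is a variable bounding those of \<phi> and of the finite set
  \<open>F\<close>. Freshness for the base theory is automatic, as that consists of sentences.
  Formulas of other shapes call for no witness.\<close>

definition witness :: "fm \<Rightarrow> fm set \<Rightarrow> fm set" where
  "witness \<phi> F = (case \<phi> of Imp (All \<psi>) Bot \<Rightarrow>
      {Neg (inst (SOME t. \<forall>\<chi>\<in>insert \<phi> F. fv_below t \<chi>) \<psi>)} | _ \<Rightarrow> {})"

lemma witness_Neg_All:
  "witness (Neg (All \<psi>)) F =
    {Neg (inst (SOME t. \<forall>\<chi>\<in>insert (Neg (All \<psi>)) F. fv_below t \<chi>) \<psi>)}"
  by (simp add: witness_def)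

lemma finite_witness: "finite (witness \<phi> F)"
  by (auto simp: witness_def split: fm.split)

lemma witness_other: "(\<nexists>\<psi>. \<phi> = Neg (All \<psi>)) \<Longrightarrow> witness \<phi> F = {}"
  by (auto simp: witness_def split: fm.split)

text \<open>All formulas are tried in the order of \<open>from_nat\<close>, and what stays
  consistent is added. The theory itself is kept outside, so that each stage is finite and a fresh
  variable exists.\<close>

primrec henkin :: "fm set \<Rightarrow> nat \<Rightarrow> fm set" where
  "henkin \<Gamma> 0 = {}"
| "henkin \<Gamma> (Suc n) = (let \<phi> = from_nat n; F = henkin \<Gamma> n in
     if consistent (insert \<phi> (\<Gamma> \<union> F)) then insert \<phi> F \<union> witness \<phi> F else F)"

lemma finite_henkin: "finite (henkin \<Gamma> n)"
  by (induction n) (auto simp: Let_def finite_witness)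

lemma consistent_henkin:
  assumes "consistent \<Gamma>" and closed: "\<And>\<chi>. \<chi> \<in> \<Gamma> \<Longrightarrow> fv_below 0 \<chi>"
  shows "consistent (\<Gamma> \<union> henkin \<Gamma> n)"
proof (induction n)
  case (Suc n)
  let ?F = "henkin \<Gamma> n" and ?\<phi> = "from_nat n :: fm"
  show ?case
  \<comment> \<open>Only an accepted negated universal brings a witness; otherwise the stage is
    unchanged or gains one formula that has just passed the consistency test.\<close>
  proof (cases "consistent (insert ?\<phi> (\<Gamma> \<union> ?F)) \<and> (\<exists>\<psi>. ?\<phi> = Neg (All \<psi>))")
    case True
    then obtain \<psi> where \<psi>: "?\<phi> = Neg (All \<psi>)" by auto
    define t where "t = (SOME t. \<forall>\<chi>\<in>insert ?\<phi> ?F. fv_below t \<chi>)"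
    have "\<forall>\<chi>\<in>insert ?\<phi> ?F. fv_below t \<chi>"
      unfolding t_def by (rule someI_ex, rule fresh_exists) (simp add: finite_henkin)
    moreover have "fv_below t \<chi>" if "\<chi> \<in> \<Gamma>" for \<chi>
      using closed[OF that] by (rule fv_below_mono) simp
    ultimately have "consistent (insert (Neg (inst t \<psi>)) (insert (Neg (All \<psi>)) (\<Gamma> \<union> ?F)))"
      using True unfolding \<psi> by (intro consistent_witness) auto
    moreover have "\<Gamma> \<union> henkin \<Gamma> (Suc n) =
        insert (Neg (inst t \<psi>)) (insert (Neg (All \<psi>)) (\<Gamma> \<union> ?F))"
      using True by (auto simp: Let_def \<psi> witness_Neg_All t_def)
    ultimately show ?thesis by simp
  next
    case False
    with Suc show ?thesis by (auto simp: Let_def witness_other)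
  qed
qed (simp add: assms)

lemma henkin_mono: "m \<le> n \<Longrightarrow> henkin \<Gamma> m \<subseteq> henkin \<Gamma> n"
  by (rule lift_Suc_mono_le[of "henkin \<Gamma>"]) (auto simp: Let_def)

locale henkin_set =
  fixes \<Gamma> :: "fm set"
  assumes cons: "consistent \<Gamma>" and closed: "\<And>\<chi>. \<chi> \<in> \<Gamma> \<Longrightarrow> fv_below 0 \<chi>"
begin

definition H :: "fm set" where
  "H = \<Gamma> \<union> (\<Union>n. henkin \<Gamma> n)"

lemma consistent_H: "consistent H"
proof (rule ccontr)
  assume "\<not> consistent H"
  then obtain F where F: "finite F" "F \<subseteq> H" "F \<turnstile> Bot"
    using proves_finite unfolding consistent_def by blast
  have "\<exists>n. F \<subseteq> \<Gamma> \<union> henkin \<Gamma> n"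
    using F(1,2)
  proof (induction F)
    case (insert \<phi> F)
    then obtain m n where "F \<subseteq> \<Gamma> \<union> henkin \<Gamma> m" "\<phi> \<in> \<Gamma> \<union> henkin \<Gamma> n"
      by (auto simp: H_def)
    then show ?case
      using henkin_mono[of m "max m n" \<Gamma>] henkin_mono[of n "max m n" \<Gamma>]
      by (intro exI[of _ "max m n"]) auto
  qed auto
  with F(3) show False
    using consistent_henkin[OF cons closed] proves_mono unfolding consistent_def by blast
qed

text \<open>The formula comes up at stage \<open>to_nat \<phi>\<close>; being consistent with all of
  \<open>H\<close>, it passes the test against the smaller set of that stage.\<close>

lemma henkin_step:
  assumes "consistent (insert \<phi> H)"
  shows "\<exists>n. insert \<phi> (witness \<phi> (henkin \<Gamma> n)) \<subseteq> H"
proof -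
  let ?n = "to_nat \<phi>"
  have "consistent (insert \<phi> (\<Gamma> \<union> henkin \<Gamma> ?n))"
    using assms unfolding consistent_def H_def
    by (metis Sup_upper UNIV_I image_eqI insert_mono proves_mono sup.mono subset_refl)
  then have "insert \<phi> (witness \<phi> (henkin \<Gamma> ?n)) \<subseteq> henkin \<Gamma> (Suc ?n)"
    by (auto simp: Let_def)
  then show ?thesis unfolding H_def by blast
qed

text \<open>A derivable formula is consistent with \<open>H\<close> and was therefore added at its
  stage. This lets the rules of the calculus be read as closure properties of
  \<open>H\<close>.\<close>

lemma in_H_iff: "\<phi> \<in> H \<longleftrightarrow> H \<turnstile> \<phi>"
proof
  assume \<phi>: "H \<turnstile> \<phi>"
  have "consistent (insert \<phi> H)"
    using consistent_H \<phi> unfolding consistent_def by (meson ImpE ImpI)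
  then show "\<phi> \<in> H" using henkin_step by blast
qed (rule Assm)

lemma Neg_in_H: "Neg \<phi> \<in> H \<longleftrightarrow> \<phi> \<notin> H"
proof
  assume "Neg \<phi> \<in> H"
  then show "\<phi> \<notin> H" using consistent_H unfolding in_H_iff consistent_def by (meson ImpE)
next
  assume "\<phi> \<notin> H"
  then have "\<not> consistent (insert \<phi> H)" using henkin_step by blast
  then show "Neg \<phi> \<in> H" unfolding in_H_iff consistent_def by (meson ImpI)
qed

lemma Bot_notin_H: "Bot \<notin> H"
  using consistent_H by (simp add: in_H_iff consistent_def)

lemma Imp_in_H: "Imp \<phi> \<psi> \<in> H \<longleftrightarrow> (\<phi> \<in> H \<longrightarrow> \<psi> \<in> H)"
proof
  assume "Imp \<phi> \<psi> \<in> H"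
  then show "\<phi> \<in> H \<longrightarrow> \<psi> \<in> H" unfolding in_H_iff by (meson ImpE)
next
  assume *: "\<phi> \<in> H \<longrightarrow> \<psi> \<in> H"
  show "Imp \<phi> \<psi> \<in> H"
  proof (cases "\<psi> \<in> H")
    case True
    then show ?thesis unfolding in_H_iff by (meson ImpI proves_mono subset_insertI)
  next
    case False
    with * have "Neg \<phi> \<in> H" by (simp add: Neg_in_H)
    then have "insert (Neg \<psi>) (insert \<phi> H) \<turnstile> Bot"
      by (meson Assm ImpE insertCI)
    then show ?thesis unfolding in_H_iff by (meson Classical ImpI)
  qed
qed

lemma All_in_H: "All \<psi> \<in> H \<longleftrightarrow> (\<forall>t. inst t \<psi> \<in> H)"
proof
  assume "All \<psi> \<in> H"
  then show "\<forall>t. inst t \<psi> \<in> H" unfolding in_H_iff by (simp add: AllE)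
next
  assume *: "\<forall>t. inst t \<psi> \<in> H"
  show "All \<psi> \<in> H"
  proof (rule ccontr)
    assume "All \<psi> \<notin> H"
    then have "Neg (All \<psi>) \<in> H" by (simp add: Neg_in_H)
    then have "consistent (insert (Neg (All \<psi>)) H)"
      using consistent_H by (simp add: insert_absorb)
    \<comment> \<open>The stage that added the negated universal also added its negated instance at
      a fresh variable.\<close>
    from henkin_step[OF this] obtain t where "Neg (inst t \<psi>) \<in> H"
      unfolding witness_Neg_All by auto
    with * show False by (simp add: Neg_in_H)
  qed
qed

section \<open>Term model: variables modulo provable equality\<close>

lemma Eq_in_H_subst: "Eq i j \<in> H \<Longrightarrow> inst i \<phi> \<in> H \<Longrightarrow> inst j \<phi> \<in> H"
  unfolding in_H_iff by (rule EqE)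

lemma Eq_in_H_refl: "Eq i i \<in> H"
  unfolding in_H_iff by (rule EqI)

lemma Eq_in_H_sym: "Eq i j \<in> H \<Longrightarrow> Eq j i \<in> H"
  using Eq_in_H_subst[of i j "Eq 0 (Suc i)"] Eq_in_H_refl by (simp add: inst_def)

lemma Eq_in_H_trans: "Eq i j \<in> H \<Longrightarrow> Eq j k \<in> H \<Longrightarrow> Eq i k \<in> H"
  using Eq_in_H_subst[of j k "Eq (Suc i) 0"] by (simp add: inst_def)

lemma Mem_in_H_cong:
  assumes "Eq i i' \<in> H" "Eq j j' \<in> H" "Mem i j \<in> H" shows "Mem i' j' \<in> H"
  using Eq_in_H_subst[of i i' "Mem 0 (Suc j)"] Eq_in_H_subst[of j j' "Mem (Suc i') 0"] assms
  by (simp add: inst_def)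

text \<open>The least member represents its class, which keeps the domain a set of naturals instead
  of a set of classes.\<close>

definition rep :: "nat \<Rightarrow> nat" where
  "rep i = (LEAST j. Eq i j \<in> H)"

lemma Eq_rep: "Eq i (rep i) \<in> H"
  unfolding rep_def by (rule LeastI[of _ i]) (rule Eq_in_H_refl)

lemma rep_eq_iff: "rep i = rep j \<longleftrightarrow> Eq i j \<in> H"
proof
  assume "rep i = rep j"
  then show "Eq i j \<in> H" using Eq_rep[of i] Eq_rep[of j] by (metis Eq_in_H_sym Eq_in_H_trans)
next
  assume "Eq i j \<in> H"
  then have "Eq i k \<in> H \<longleftrightarrow> Eq j k \<in> H" for k by (metis Eq_in_H_sym Eq_in_H_trans)
  then show "rep i = rep j" by (simp add: rep_def)
qed

text \<open>The renaming is general because the induction passes under a quantifier: giving the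
  bound variable the value \<open>rep t\<close> amounts to extending \<open>r\<close> by
  \<open>t\<close>, and \<open>All_in_H\<close> accounts for all such instances.\<close>

lemma truth:
  "sat (range rep) (\<lambda>a b. Mem a b \<in> H) (\<lambda>i. rep (r i)) \<phi> \<longleftrightarrow> ren r \<phi> \<in> H"
proof (induction \<phi> arbitrary: r)
  case (Mem i j)
  show ?case
    using Mem_in_H_cong[of "r i" "rep (r i)" "r j" "rep (r j)"]
      Mem_in_H_cong[of "rep (r i)" "r i" "rep (r j)" "r j"] Eq_rep Eq_in_H_sym by auto
next
  case (All \<phi>)
  have 1: "case_nat (rep t) (\<lambda>i. rep (r i)) = (\<lambda>i. rep (case_nat t r i))" for t
    by (auto simp: fun_eq_iff split: nat.split)
  have 2: "inst t (ren (lift_ren r) \<phi>) = ren (case_nat t r) \<phi>" for t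
    unfolding inst_def ren_ren
    by (rule arg_cong[where f = "\<lambda>r. ren r \<phi>"]) (auto simp: fun_eq_iff split: nat.split)
  show ?case by (simp add: All_in_H 1 2 All.IH)
qed (auto simp: rep_eq_iff Bot_notin_H Imp_in_H)

end

lemma model_existence:
  assumes "consistent \<Gamma>" and closed: "\<And>\<chi>. \<chi> \<in> \<Gamma> \<Longrightarrow> fv_below 0 \<chi>"
  shows "\<exists>(D :: nat set) M. \<forall>\<chi>\<in>\<Gamma>. \<forall>e. sat D M e \<chi>"
proof -
  interpret henkin_set \<Gamma> by unfold_locales fact+
  have "sat (range rep) (\<lambda>a b. Mem a b \<in> H) e \<chi>" if \<chi>: "\<chi> \<in> \<Gamma>" for e \<chi>
  proof -
    have "sat (range rep) (\<lambda>a b. Mem a b \<in> H) (\<lambda>i. rep i) \<chi>"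
      using truth[of "\<lambda>i. i" \<chi>] \<chi> by (simp add: ren_ident H_def)
    then show ?thesis using sat_cong[OF closed[OF \<chi>]] by (metis not_less_zero)
  qed
  then show ?thesis by blast
qed

section \<open>Definability with parameters\<close>

lemma sat_connectives:
  "sat D M e ((p \<^bold>\<longrightarrow> q) d) \<longleftrightarrow> (sat D M e (p d) \<longrightarrow> sat D M e (q d))"
  "sat D M e ((\<^bold>\<not> p) d) \<longleftrightarrow> \<not> sat D M e (p d)"
  "sat D M e ((p \<^bold>\<and> q) d) \<longleftrightarrow> sat D M e (p d) \<and> sat D M e (q d)"
  "sat D M e ((p \<^bold>\<or> q) d) \<longleftrightarrow> sat D M e (p d) \<or> sat D M e (q d)"
  "sat D M e ((p \<^bold>\<longleftrightarrow> q) d) \<longleftrightarrow> (sat D M e (p d) \<longleftrightarrow> sat D M e (q d))"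
  "sat D M e (fall P d) \<longleftrightarrow> (\<forall>a\<in>D. sat D M (case_nat a e) (P d (Suc d)))"
  "sat D M e (fex P d) \<longleftrightarrow> (\<exists>a\<in>D. sat D M (case_nat a e) (P d (Suc d)))"
  by (auto simp: fimp_def fnot_def fand_def f_or_def fiff_def fall_def fex_def)

locale membership =
  fixes M :: "'a \<Rightarrow> 'a \<Rightarrow> bool"
begin

definition el :: "'a \<Rightarrow> 'a set" where
  "el x = {z. M z x}"

text \<open>The parameters of a definable predicate enter as constant terms.\<close>

definition trm :: "((nat \<Rightarrow> 'a) \<Rightarrow> 'a) \<Rightarrow> bool" where
  "trm t \<longleftrightarrow> (\<exists>i. t = (\<lambda>e. e i)) \<or> (\<exists>c. t = (\<lambda>e. c))"

text \<open>\<open>t\<close> says where each free variable of \<phi> is read: at a place of the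
  environment or from a fixed parameter. As \<open>t\<close> is chosen anew for each formula,
  parameters need no common numbering.\<close>

definition definable :: "((nat \<Rightarrow> 'a) \<Rightarrow> bool) \<Rightarrow> bool" where
  "definable P \<longleftrightarrow> (\<exists>\<phi> t. (\<forall>i. trm (t i)) \<and> (\<forall>e. P e \<longleftrightarrow> sat UNIV M (\<lambda>i. t i e) \<phi>))"

lemma trm_var: "trm (\<lambda>e. e i)"
  by (auto simp: trm_def)

lemma trm_const: "trm (\<lambda>e. c)"
  by (auto simp: trm_def)

lemma trm_compose:
  assumes "trm t" "\<And>i. trm (s i)" shows "trm (\<lambda>e. t (\<lambda>i. s i e))"
  using assms by (auto simp: trm_def)

lemma trm_shift: "trm t \<Longrightarrow> trm (\<lambda>e. t (\<lambda>i. e (Suc i)))"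
  using trm_compose[of t "\<lambda>i e. e (Suc i)"] by (simp add: trm_var)

lemma definable_compose:
  assumes "definable P" "\<And>i. trm (s i)" shows "definable (\<lambda>e. P (\<lambda>i. s i e))"
proof -
  from assms(1) obtain \<phi> t where "\<forall>i. trm (t i)" "\<forall>e. P e \<longleftrightarrow> sat UNIV M (\<lambda>i. t i e) \<phi>"
    unfolding definable_def by auto
  with assms(2) show ?thesis unfolding definable_def
    by (intro exI[of _ \<phi>] exI[of _ "\<lambda>i e. t i (\<lambda>i. s i e)"]) (auto intro: trm_compose)
qed

lemma definable_subst1:
  assumes "definable (\<lambda>e. P (e 0))" "trm a" shows "definable (\<lambda>e. P (a e))"
  using definable_compose[OF assms(1), of "\<lambda>i. a"] assms(2) by simp

lemma definable_subst2:
  assumes "definable (\<lambda>e. P (e 0) (e 1))" "trm a" "trm b"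
  shows "definable (\<lambda>e. P (a e) (b e))"
  using definable_compose[OF assms(1), of "\<lambda>i. if i = 0 then a else b"] assms(2,3) by simp

lemma definable_subst3:
  assumes "definable (\<lambda>e. P (e 0) (e 1) (e 2))" "trm a" "trm b" "trm c"
  shows "definable (\<lambda>e. P (a e) (b e) (c e))"
  using definable_compose[OF assms(1), of "\<lambda>i. if i = 0 then a else if i = 1 then b else c"]
    assms(2-4) by simp

lemma definable_eq:
  assumes "trm a" "trm b" shows "definable (\<lambda>e. a e = b e)"
  unfolding definable_def
  by (intro exI[of _ "Eq 0 1"] exI[of _ "\<lambda>i. if i = 0 then a else b"]) (use assms in auto)

lemma definable_mem:
  assumes "trm a" "trm b" shows "definable (\<lambda>e. a e \<in> el (b e))"
  unfolding definable_def
  by (intro exI[of _ "Mem 0 1"] exI[of _ "\<lambda>i. if i = 0 then a else b"])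
    (use assms in \<open>auto simp: el_def\<close>)

lemma definable_False: "definable (\<lambda>e. False)"
  unfolding definable_def by (intro exI[of _ Bot] exI[of _ "\<lambda>i e. e i"]) (simp add: trm_var)

lemma definable_imp:
  assumes "definable P" "definable Q" shows "definable (\<lambda>e. P e \<longrightarrow> Q e)"
proof -
  from assms obtain \<phi> s \<psi> t where
    "\<forall>i. trm (s i)" "\<forall>e. P e \<longleftrightarrow> sat UNIV M (\<lambda>i. s i e) \<phi>"
    "\<forall>i. trm (t i)" "\<forall>e. Q e \<longleftrightarrow> sat UNIV M (\<lambda>i. t i e) \<psi>"
    unfolding definable_def by metis
  \<comment> \<open>The two formulas may read the same variable from different sources; even and odd
    indices keep the sources apart.\<close>
  then show ?thesis unfolding definable_def
    by (intro exI[of _ "Imp (ren (\<lambda>i. 2 * i) \<phi>) (ren (\<lambda>i. Suc (2 * i)) \<psi>)"]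
        exI[of _ "\<lambda>i. if even i then s (i div 2) else t (i div 2)"]) (simp add: sat_ren)
qed

lemma definable_not: "definable P \<Longrightarrow> definable (\<lambda>e. \<not> P e)"
  using definable_imp[OF _ definable_False] by simp

lemma definable_disj: "definable P \<Longrightarrow> definable Q \<Longrightarrow> definable (\<lambda>e. P e \<or> Q e)"
  using definable_imp[OF definable_not] by (simp add: imp_conv_disj)

lemma definable_conj: "definable P \<Longrightarrow> definable Q \<Longrightarrow> definable (\<lambda>e. P e \<and> Q e)"
  using definable_not[OF definable_imp[OF _ definable_not]] by simp

lemma definable_iff: "definable P \<Longrightarrow> definable Q \<Longrightarrow> definable (\<lambda>e. P e \<longleftrightarrow> Q e)"
  unfolding iff_conv_conj_imp by (intro definable_conj definable_imp)

lemma definable_all: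
  assumes "definable (\<lambda>e. P (e 0) (\<lambda>i. e (Suc i)))" shows "definable (\<lambda>e. \<forall>y. P y e)"
proof -
  from assms obtain \<phi> t where t: "\<forall>i. trm (t i)"
    and \<phi>: "\<And>e. P (e 0) (\<lambda>i. e (Suc i)) \<longleftrightarrow> sat UNIV M (\<lambda>i. t i e) \<phi>"
    unfolding definable_def by auto
  \<comment> \<open>Variables that read the environment at 0 become the quantified index 0. The
    others move to \<open>Suc i\<close> and read an environment from which the first place is
    removed; the default \<open>undefined\<close> in that place is not seen by them.\<close>
  define r where "r i = (if t i = (\<lambda>e. e 0) then 0 else Suc i)" for i
  define t' where "t' i e = t i (case_nat undefined e)" for i e
  have t': "trm (t' i)" for i
  proof -
    have "trm (\<lambda>e. case_nat undefined e j)" for j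
      by (cases j) (auto simp: trm_var trm_const)
    with t show ?thesis unfolding t'_def[abs_def] by (rule_tac trm_compose) auto
  qed
  have eq: "t i (case_nat y e) = case_nat y (\<lambda>i. t' i e) (r i)" for i y e
  proof (cases "t i = (\<lambda>e. e 0)")
    case False
    with t[rule_format, of i] have "(\<exists>j. t i = (\<lambda>e. e (Suc j))) \<or> (\<exists>c. t i = (\<lambda>e. c))"
      unfolding trm_def by (metis not0_implies_Suc)
    with False show ?thesis by (auto simp: r_def t'_def)
  qed (simp add: r_def)
  have "P y e \<longleftrightarrow> sat UNIV M (case_nat y (\<lambda>i. t' i e)) (ren r \<phi>)" for y e
    using \<phi>[of "case_nat y e"] by (simp add: eq sat_ren)
  then show ?thesis unfolding definable_def using t'
    by (intro exI[of _ "All (ren r \<phi>)"] exI[of _ t']) simp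
qed

lemma definable_ex:
  "definable (\<lambda>e. P (e 0) (\<lambda>i. e (Suc i))) \<Longrightarrow> definable (\<lambda>e. \<exists>y. P y e)"
  using definable_not[OF definable_all[of "\<lambda>y e. \<not> P y e", OF definable_not]] by simp

lemma definable_ball:
  "trm a \<Longrightarrow> definable (\<lambda>e. P (e 0) (\<lambda>i. e (Suc i))) \<Longrightarrow> definable (\<lambda>e. \<forall>y\<in>el (a e). P y e)"
  unfolding Ball_def by (intro definable_all definable_imp definable_mem trm_var trm_shift)

lemma definable_bex:
  "trm a \<Longrightarrow> definable (\<lambda>e. P (e 0) (\<lambda>i. e (Suc i))) \<Longrightarrow> definable (\<lambda>e. \<exists>y\<in>el (a e). P y e)"
  unfolding Bex_def by (intro definable_ex definable_conj definable_mem trm_var trm_shift)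

lemmas definable_intros = definable_eq definable_mem definable_not definable_imp definable_conj
  definable_disj definable_iff definable_all definable_ex definable_ball definable_bex
  trm_var trm_const

text \<open>\<open>h\<close> is total on the type; a map that matters only on a set is usually
  extended by the identity, which keeps its graph definable.\<close>

definition fun_definable :: "('a \<Rightarrow> 'a) \<Rightarrow> bool" where
  "fun_definable h \<longleftrightarrow> definable (\<lambda>e. e 1 = h (e 0))"

lemma fun_definableI:
  "definable (\<lambda>e. R (e 0) (e 1)) \<Longrightarrow> (\<And>x y. y = h x \<longleftrightarrow> R x y) \<Longrightarrow> fun_definable h"
  by (simp add: fun_definable_def)

text \<open>Values of \<open>h\<close> are not terms. Later predicates therefore mention
  \<open>h\<close> only in equations and name intermediate values by bound variables.\<close>

lemma definable_fun_eq:
  assumes "fun_definable h" "trm a" "trm b" shows "definable (\<lambda>e. a e = h (b e))"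
  using definable_subst2[of "\<lambda>x y. y = h x"] assms by (simp add: fun_definable_def)

lemma fun_definable_comp:
  assumes "fun_definable g" "fun_definable h" shows "fun_definable (\<lambda>x. g (h x))"
proof (rule fun_definableI)
  show "definable (\<lambda>e. \<exists>z. z = h (e 0) \<and> e 1 = g z)"
    by (intro definable_fun_eq[OF assms(1)] definable_fun_eq[OF assms(2)] definable_intros)
qed simp

lemma fun_definable_id: "fun_definable (\<lambda>x. x)"
  unfolding fun_definable_def by (intro definable_intros)

section \<open>The semantics of the readable formulas\<close>

text \<open>
  The value of a form below \<open>d\<close> quantifiers, where the assignment \<open>v\<close> is indexed by levels.
  Indices from \<open>d\<close> on, which do not occur, get a junk value.
\<close>

definition ev :: "form \<Rightarrow> nat \<Rightarrow> (nat \<Rightarrow> 'a) \<Rightarrow> bool" where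
  "ev p d v \<longleftrightarrow> sat UNIV M (\<lambda>i. if i < d then v (d - Suc i) else undefined) (p d)"

lemma ev_feq [simp]: "x < d \<Longrightarrow> y < d \<Longrightarrow> ev (x \<^bold>= y) d v \<longleftrightarrow> v x = v y"
  by (simp add: ev_def feq_def)

lemma ev_fmem [simp]: "x < d \<Longrightarrow> y < d \<Longrightarrow> ev (x \<^bold>\<in> y) d v \<longleftrightarrow> v x \<in> el (v y)"
  by (simp add: ev_def fmem_def el_def)

lemma ev_connectives [simp]:
  "ev (p \<^bold>\<longrightarrow> q) d v \<longleftrightarrow> (ev p d v \<longrightarrow> ev q d v)"
  "ev (\<^bold>\<not> p) d v \<longleftrightarrow> \<not> ev p d v"
  "ev (p \<^bold>\<and> q) d v \<longleftrightarrow> ev p d v \<and> ev q d v"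
  "ev (p \<^bold>\<or> q) d v \<longleftrightarrow> ev p d v \<or> ev q d v"
  "ev (p \<^bold>\<longleftrightarrow> q) d v \<longleftrightarrow> (ev p d v \<longleftrightarrow> ev q d v)"
  by (simp_all add: ev_def sat_connectives)

text \<open>The binder hands level \<open>d\<close> to its body, hence the update at
  \<open>d\<close>; the new value sits at de Bruijn index 0, as \<open>Suc d - Suc 0\<close> is
  \<open>d\<close>.\<close>

lemma ev_fall [simp]: "ev (fall P) d v \<longleftrightarrow> (\<forall>a. ev (P d) (Suc d) (v(d := a)))"
proof -
  have "case_nat a (\<lambda>i. if i < d then v (d - Suc i) else undefined) =
      (\<lambda>i. if i < Suc d then (v(d := a)) (Suc d - Suc i) else undefined)" for a
    by (auto simp: fun_eq_iff split: nat.split)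
  then show ?thesis by (simp add: ev_def fall_def)
qed

lemma ev_fex [simp]: "ev (fex P) d v \<longleftrightarrow> (\<exists>a. ev (P d) (Suc d) (v(d := a)))"
  by (simp add: fex_def)

lemma upd_below [simp]: "x < d \<Longrightarrow> (v(d := a)) x = v x" for x d :: nat
  by simp

lemma ev_holds:
  assumes "fv_below n \<phi>" "\<And>i. i < n \<Longrightarrow> r i < d"
  shows "ev (holds \<phi> r) d v \<longleftrightarrow> sat UNIV M (\<lambda>i. v (r i)) \<phi>"
  unfolding ev_def holds_def sat_ren
proof (rule sat_cong[OF assms(1)])
  fix i assume "i < n"
  with assms(2) have "r i < d" by simp
  then show "(if d - Suc (r i) < d then v (d - Suc (d - Suc (r i))) else undefined) = v (r i)"
    by simp
qed

definition succ_closed :: "'a \<Rightarrow> bool" where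
  "succ_closed w \<longleftrightarrow> (\<exists>x. el x = {} \<and> x \<in> el w) \<and>
    (\<forall>x\<in>el w. \<exists>y. el y = insert x (el x) \<and> y \<in> el w)"

definition omega :: "'a \<Rightarrow> bool" where
  "omega w \<longleftrightarrow> succ_closed w \<and> (\<forall>v. succ_closed v \<longrightarrow> el w \<subseteq> el v)"

definition opair :: "'a \<Rightarrow> 'a \<Rightarrow> 'a \<Rightarrow> bool" where
  "opair p x y \<longleftrightarrow> (\<forall>u. u \<in> el p \<longleftrightarrow> el u = {x} \<or> el u = {x, y})"

definition mapsto :: "'a \<Rightarrow> 'a \<Rightarrow> 'a \<Rightarrow> bool" where
  "mapsto f x y \<longleftrightarrow> (\<exists>p. opair p x y \<and> p \<in> el f)"

definition injection :: "'a \<Rightarrow> 'a \<Rightarrow> 'a \<Rightarrow> bool" where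
  "injection f X Y \<longleftrightarrow> (\<forall>p\<in>el f. \<exists>x\<in>el X. \<exists>y\<in>el Y. opair p x y) \<and>
    (\<forall>x\<in>el X. \<exists>y. mapsto f x y \<and> (\<forall>z. mapsto f x z \<longrightarrow> z = y)) \<and>
    (\<forall>x x' y. mapsto f x y \<and> mapsto f x' y \<longrightarrow> x = x')"

definition bijection :: "'a \<Rightarrow> 'a \<Rightarrow> 'a \<Rightarrow> bool" where
  "bijection f X Y \<longleftrightarrow> injection f X Y \<and> (\<forall>y\<in>el Y. \<exists>x. mapsto f x y)"

definition graph :: "'a \<Rightarrow> 'a \<Rightarrow> bool" where
  "graph V E \<longleftrightarrow> (\<forall>e\<in>el E. \<exists>x\<in>el V. \<exists>y\<in>el V. x \<noteq> y \<and> el e = {x, y})"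

definition adj :: "'a \<Rightarrow> 'a \<Rightarrow> 'a \<Rightarrow> bool" where
  "adj E x y \<longleftrightarrow> (\<exists>e. el e = {x, y} \<and> e \<in> el E)"

definition independent :: "'a \<Rightarrow> 'a \<Rightarrow> 'a \<Rightarrow> bool" where
  "independent V E I \<longleftrightarrow> el I \<subseteq> el V \<and> (\<forall>x\<in>el I. \<forall>y\<in>el I. x \<noteq> y \<longrightarrow> \<not> adj E x y)"

definition clique_in :: "'a \<Rightarrow> 'a \<Rightarrow> 'a \<Rightarrow> bool" where
  "clique_in V E V' \<longleftrightarrow> (\<exists>E'. (graph V' E' \<and> el V' \<subseteq> el V \<and> el E' \<subseteq> el E) \<and>
    (\<forall>x\<in>el V'. \<forall>y\<in>el V'. x \<noteq> y \<longrightarrow> adj E' x y))"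

lemma ev_is_subset [simp]: "x < d \<Longrightarrow> y < d \<Longrightarrow> ev (x \<^bold>\<subseteq> y) d v \<longleftrightarrow> el (v x) \<subseteq> el (v y)"
  by (auto simp: is_subset_def)

lemma ev_is_empty [simp]: "x < d \<Longrightarrow> ev (is_empty x) d v \<longleftrightarrow> el (v x) = {}"
  by (auto simp: is_empty_def)

lemma ev_is_succ [simp]:
  "y < d \<Longrightarrow> x < d \<Longrightarrow> ev (is_succ y x) d v \<longleftrightarrow> el (v y) = insert (v x) (el (v x))"
  by (auto simp: is_succ_def set_eq_iff)

lemma ev_is_inductive [simp]: "w < d \<Longrightarrow> ev (is_inductive w) d v \<longleftrightarrow> succ_closed (v w)"
  by (auto simp: is_inductive_def succ_closed_def)

lemma ev_is_omega [simp]: "w < d \<Longrightarrow> ev (is_omega w) d v \<longleftrightarrow> omega (v w)"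
  by (auto simp: is_omega_def omega_def)

lemma ev_is_upair [simp]:
  "u < d \<Longrightarrow> x < d \<Longrightarrow> y < d \<Longrightarrow> ev (is_upair u x y) d v \<longleftrightarrow> el (v u) = {v x, v y}"
  by (auto simp: is_upair_def set_eq_iff)

lemma ev_is_opair [simp]:
  "p < d \<Longrightarrow> x < d \<Longrightarrow> y < d \<Longrightarrow> ev (is_opair p x y) d v \<longleftrightarrow> opair (v p) (v x) (v y)"
  by (simp add: is_opair_def opair_def)

lemma ev_maps [simp]:
  "f < d \<Longrightarrow> x < d \<Longrightarrow> y < d \<Longrightarrow> ev (maps f x y) d v \<longleftrightarrow> mapsto (v f) (v x) (v y)"
  by (simp add: maps_def mapsto_def)

lemma ev_is_injection [simp]:
  "f < d \<Longrightarrow> X < d \<Longrightarrow> Y < d \<Longrightarrow>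
    ev (is_injection f X Y) d v \<longleftrightarrow> injection (v f) (v X) (v Y)"
  by (auto simp: is_injection_def is_function_def injection_def Ball_def Bex_def)

lemma ev_is_bijection [simp]:
  "f < d \<Longrightarrow> X < d \<Longrightarrow> Y < d \<Longrightarrow>
    ev (is_bijection f X Y) d v \<longleftrightarrow> bijection (v f) (v X) (v Y)"
  by (auto simp: is_bijection_def bijection_def)

lemma ev_is_graph [simp]: "V < d \<Longrightarrow> E < d \<Longrightarrow> ev (is_graph V E) d v \<longleftrightarrow> graph (v V) (v E)"
  by (auto simp: is_graph_def graph_def Ball_def Bex_def)

lemma ev_adjacent [simp]:
  "E < d \<Longrightarrow> x < d \<Longrightarrow> y < d \<Longrightarrow> ev (adjacent E x y) d v \<longleftrightarrow> adj (v E) (v x) (v y)"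
  by (simp add: adjacent_def adj_def)

lemma ev_is_independent [simp]:
  "V < d \<Longrightarrow> E < d \<Longrightarrow> I < d \<Longrightarrow>
    ev (is_independent V E I) d v \<longleftrightarrow> independent (v V) (v E) (v I)"
  by (auto simp: is_independent_def independent_def)

definition edm :: "('a \<Rightarrow> bool) \<Rightarrow> ('a \<Rightarrow> bool) \<Rightarrow> ('a \<Rightarrow> 'a \<Rightarrow> bool) \<Rightarrow> bool" where
  "edm U B C \<longleftrightarrow> (\<forall>V E. graph V E \<and> U V \<longrightarrow>
    (\<exists>I. independent V E I \<and> B I) \<or> (\<exists>V'. clique_in V E V' \<and> C V V'))"

lemma ev_EDM:
  assumes "\<And>x d v. x < d \<Longrightarrow> ev (nle_aleph0 x) d v \<longleftrightarrow> U (v x)"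
    and "\<And>x d v. x < d \<Longrightarrow> ev (B x) d v \<longleftrightarrow> B' (v x)"
    and "\<And>x y d v. x < d \<Longrightarrow> y < d \<Longrightarrow> ev (C x y) d v \<longleftrightarrow> C' (v x) (v y)"
  shows "ev (EDM B C) d v \<longleftrightarrow> edm U B' C'"
  unfolding EDM_def edm_def clique_in_def is_subgraph_def is_clique_def
  by (simp add: assms Ball_def imp_conjL flip: ex_simps(1))

end

section \<open>Set theory in a model of ZF\<close>

text \<open>Separation is assumed for \<open>definable\<close> predicates, which already carry their
  parameters, so that formulas stay out of the set theory below.\<close>

locale zf_model = membership M for M :: "'a \<Rightarrow> 'a \<Rightarrow> bool" +
  assumes ext: "el x = el y \<Longrightarrow> x = y"
    and upair_ex: "\<exists>u. el u = {x, y}"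
    and union_ex: "\<exists>u. el u = (\<Union>y\<in>el x. el y)"
    and pow_ex: "\<exists>u. el u = {z. el z \<subseteq> el x}"
    and foundation: "el x \<noteq> {} \<Longrightarrow> \<exists>y\<in>el x. el x \<inter> el y = {}"
    and succ_closed_ex: "\<exists>w. succ_closed w"
    and sep: "definable (\<lambda>e. P (e 0)) \<Longrightarrow> \<exists>b. el b = {x \<in> el a. P x}"
begin

text \<open>Definability of \<open>h\<close> is essential: an arbitrary HOL injection need not
  belong to the model. \<open>emb_iff\<close> identifies this with the existence of an internal
  injection.\<close>

definition emb :: "'a \<Rightarrow> 'a \<Rightarrow> bool" where
  "emb X Y \<longleftrightarrow> (\<exists>h. fun_definable h \<and> inj_on h (el X) \<and> h ` el X \<subseteq> el Y)"

definition equip :: "'a \<Rightarrow> 'a \<Rightarrow> bool" where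
  "equip X Y \<longleftrightarrow> (\<exists>h. fun_definable h \<and> bij_betw h (el X) (el Y))"

section \<open>Ordered pairs, and coding definable maps as elements of the model\<close>

lemma opair_inj:
  assumes "opair p x y" "opair p x' y'" shows "x = x' \<and> y = y'"
proof -
  obtain s where s: "el s = {x}" using upair_ex[of x x] by auto
  obtain t where t: "el t = {x, y}" using upair_ex by blast
  obtain s' where s': "el s' = {x'}" using upair_ex[of x' x'] by auto
  obtain t' where t': "el t' = {x', y'}" using upair_ex by blast
  have "s \<in> el p" "t \<in> el p" "s' \<in> el p" "t' \<in> el p"
    using assms s t s' t' unfolding opair_def by blast+
  then have "{x} = {x'} \<or> {x} = {x', y'}" "{x, y} = {x'} \<or> {x, y} = {x', y'}"
    "{x', y'} = {x} \<or> {x', y'} = {x, y}"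
    using assms s t s' t' unfolding opair_def by metis+
  then show ?thesis by (auto simp: doubleton_eq_iff)
qed

lemma opair_ex: "\<exists>p. opair p x y"
proof -
  obtain s where s: "el s = {x}" using upair_ex[of x x] by auto
  obtain t where t: "el t = {x, y}" using upair_ex by blast
  obtain p where "el p = {s, t}" using upair_ex by blast
  then have "opair p x y" unfolding opair_def using s t ext by (metis insert_iff singletonD)
  then show ?thesis ..
qed

lemma definable_opair:
  assumes "trm a" "trm b" "trm c" shows "definable (\<lambda>e. opair (a e) (b e) (c e))"
proof (rule definable_subst3[OF _ assms])
  show "definable (\<lambda>e. opair (e 0) (e 1) (e 2))"
    unfolding opair_def set_eq_iff insert_iff empty_iff by (intro definable_intros definable_False)
qed

lemma definable_mapsto:
  assumes "trm a" "trm b" "trm c" shows "definable (\<lambda>e. mapsto (a e) (b e) (c e))"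
proof (rule definable_subst3[OF _ assms])
  show "definable (\<lambda>e. mapsto (e 0) (e 1) (e 2))"
    unfolding mapsto_def by (intro definable_opair definable_intros)
qed

text \<open>The pairs lie in the double power set of the union of \<open>X\<close> and
  \<open>Y\<close>, from which separation cuts out the relation.\<close>

lemma relation_ex:
  assumes "definable (\<lambda>e. R (e 0) (e 1))"
  obtains f where "\<And>x y. mapsto f x y \<longleftrightarrow> x \<in> el X \<and> y \<in> el Y \<and> R x y"
    and "\<And>p. p \<in> el f \<Longrightarrow> \<exists>x\<in>el X. \<exists>y\<in>el Y. opair p x y"
proof -
  obtain P where P: "el P = {X, Y}" using upair_ex by blast
  obtain U where U: "el U = el X \<union> el Y" using union_ex[of P] P by auto
  obtain Q where Q: "el Q = {z. el z \<subseteq> el U}" using pow_ex by blast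
  obtain QQ where QQ: "el QQ = {z. el z \<subseteq> el Q}" using pow_ex by blast
  have "definable (\<lambda>e. \<exists>x\<in>el X. \<exists>y\<in>el Y. opair (e 0) x y \<and> R x y)"
    by (intro definable_opair definable_subst2[OF assms] definable_intros)
  then obtain f where f: "el f = {p \<in> el QQ. \<exists>x\<in>el X. \<exists>y\<in>el Y. opair p x y \<and> R x y}"
    using sep[where P = "\<lambda>p. \<exists>x\<in>el X. \<exists>y\<in>el Y. opair p x y \<and> R x y"] by blast
  have "mapsto f x y \<longleftrightarrow> x \<in> el X \<and> y \<in> el Y \<and> R x y" for x y
  proof
    assume "mapsto f x y"
    then show "x \<in> el X \<and> y \<in> el Y \<and> R x y"
      unfolding mapsto_def f using opair_inj by blast
  next
    assume *: "x \<in> el X \<and> y \<in> el Y \<and> R x y"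
    obtain p where p: "opair p x y" using opair_ex by blast
    have "p \<in> el QQ" using p * unfolding QQ Q U opair_def by auto
    with p * show "mapsto f x y" unfolding mapsto_def f by blast
  qed
  then show thesis by (rule that) (auto simp: f)
qed

lemma injection_code:
  assumes "injection f X Y"
  obtains h where "fun_definable h" "inj_on h (el X)" "h ` el X \<subseteq> el Y"
    "\<And>x y. x \<in> el X \<Longrightarrow> mapsto f x y \<longleftrightarrow> y = h x"
proof -
  have ex: "\<exists>!y. mapsto f x y" if "x \<in> el X" for x
    using assms that unfolding injection_def by blast
  \<comment> \<open>Off \<open>X\<close> the identity is taken, since the graph must be definable at
    every argument.\<close>
  define h where "h x = (if x \<in> el X then THE y. mapsto f x y else x)" for x
  have h: "mapsto f x y \<longleftrightarrow> y = h x" if "x \<in> el X" for x y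
    using theI'[OF ex[OF that]] ex[OF that] that by (auto simp: h_def)
  have "definable (\<lambda>e. (e 0 \<in> el X \<and> mapsto f (e 0) (e 1)) \<or> (e 0 \<notin> el X \<and> e 1 = e 0))"
    by (intro definable_mapsto definable_intros)
  then have "fun_definable h"
    by (rule fun_definableI[where R = "\<lambda>x y. (x \<in> el X \<and> mapsto f x y) \<or> (x \<notin> el X \<and> y = x)"])
      (use h in \<open>auto simp: h_def\<close>)
  moreover have "inj_on h (el X)"
    using assms h unfolding injection_def inj_on_def by metis
  moreover have "h x \<in> el Y" if x: "x \<in> el X" for x
  proof -
    obtain p where p: "opair p x (h x)" "p \<in> el f" using h[OF x] unfolding mapsto_def by blast
    then obtain x' y where "opair p x' y" "y \<in> el Y" using assms unfolding injection_def by blast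
    with p show ?thesis using opair_inj by blast
  qed
  ultimately show thesis using that h by blast
qed

lemma code_injection:
  assumes "fun_definable h" "inj_on h (el X)" "h ` el X \<subseteq> el Y"
  obtains f where "injection f X Y" "\<And>x y. mapsto f x y \<longleftrightarrow> x \<in> el X \<and> y = h x"
proof -
  obtain f where f: "\<And>x y. mapsto f x y \<longleftrightarrow> x \<in> el X \<and> y \<in> el Y \<and> y = h x"
    and fp: "\<And>p. p \<in> el f \<Longrightarrow> \<exists>x\<in>el X. \<exists>y\<in>el Y. opair p x y"
    using relation_ex[of "\<lambda>x y. y = h x"] assms(1) unfolding fun_definable_def by blast
  have f': "mapsto f x y \<longleftrightarrow> x \<in> el X \<and> y = h x" for x y using f assms(3) by blast
  moreover have "injection f X Y" unfolding injection_def f'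
    using assms(2) fp by (auto dest: inj_onD)
  ultimately show thesis using that by blast
qed

lemma emb_iff: "(\<exists>f. injection f X Y) \<longleftrightarrow> emb X Y"
  unfolding emb_def using injection_code code_injection by metis

lemma equip_iff: "(\<exists>f. bijection f X Y) \<longleftrightarrow> equip X Y"
proof
  assume "\<exists>f. bijection f X Y"
  then obtain f where f: "injection f X Y" "\<forall>y\<in>el Y. \<exists>x. mapsto f x y"
    unfolding bijection_def by blast
  from f(1) obtain h where h: "fun_definable h" "inj_on h (el X)" "h ` el X \<subseteq> el Y"
    "\<And>x y. x \<in> el X \<Longrightarrow> mapsto f x y \<longleftrightarrow> y = h x" by (rule injection_code) (rule that)
  have "x \<in> el X" if "mapsto f x y" for x y
    using that f(1) opair_inj unfolding injection_def mapsto_def by blast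
  with f(2) h(4) have "el Y \<subseteq> h ` el X" by blast
  with h show "equip X Y" unfolding equip_def bij_betw_def by blast
next
  assume "equip X Y"
  then obtain h where h: "fun_definable h" "inj_on h (el X)" "h ` el X = el Y"
    unfolding equip_def bij_betw_def by blast
  then obtain f where "injection f X Y" "\<And>x y. mapsto f x y \<longleftrightarrow> x \<in> el X \<and> y = h x"
    using code_injection by (metis order_refl)
  with h(3) show "\<exists>f. bijection f X Y" unfolding bijection_def by blast
qed

lemma emb_subset: "el X \<subseteq> el Y \<Longrightarrow> emb X Y"
  unfolding emb_def using fun_definable_id by (intro exI[of _ "\<lambda>x. x"]) auto

lemma emb_trans:
  assumes "emb X Y" "emb Y Z" shows "emb X Z"
proof -
  from assms obtain h k where "fun_definable h" "inj_on h (el X)" "h ` el X \<subseteq> el Y"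
    "fun_definable k" "inj_on k (el Y)" "k ` el Y \<subseteq> el Z" unfolding emb_def by blast
  then show ?thesis unfolding emb_def
    by (intro exI[of _ "\<lambda>x. k (h x)"]) (auto simp: fun_definable_comp inj_on_def image_subset_iff)
qed

lemma equip_emb: "equip X Y \<Longrightarrow> emb X Y"
  unfolding equip_def emb_def bij_betw_def by blast

text \<open>Inverting needs no choice: on \<open>Y\<close> the graph of the inverse is the graph of
  \<open>h\<close> read backwards, hence definable.\<close>

lemma equip_sym:
  assumes "equip X Y" shows "equip Y X"
proof -
  from assms obtain h where h: "fun_definable h" "bij_betw h (el X) (el Y)"
    unfolding equip_def by blast
  define k where "k y = (if y \<in> el Y then inv_into (el X) h y else y)" for y
  have k: "bij_betw k (el Y) (el X)"
    using bij_betw_inv_into[OF h(2)] by (rule bij_betw_cong[THEN iffD1, rotated]) (simp add: k_def)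
  have "definable (\<lambda>e. (e 0 \<in> el Y \<and> e 1 \<in> el X \<and> e 0 = h (e 1)) \<or> (e 0 \<notin> el Y \<and> e 1 = e 0))"
    by (intro definable_fun_eq[OF h(1)] definable_intros)
  then have "fun_definable k"
  proof (rule fun_definableI[where
        R = "\<lambda>y x. (y \<in> el Y \<and> x \<in> el X \<and> y = h x) \<or> (y \<notin> el Y \<and> x = y)"])
    fix y x show "x = k y \<longleftrightarrow> y \<in> el Y \<and> x \<in> el X \<and> y = h x \<or> y \<notin> el Y \<and> x = y"
      using h(2) unfolding k_def
      by (metis bij_betw_inv_into_left bij_betw_inv_into_right bij_betw_def inv_into_into)
  qed
  with k show ?thesis unfolding equip_def by blast
qed

text \<open>
  The least subset \<open>A\<close> of \<open>X\<close> containing \<open>X - g[Y]\<close> and closed under \<open>g \<circ> f\<close> exists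
  by separation; \<open>f\<close> on \<open>A\<close> and the inverse of \<open>g\<close> off \<open>A\<close> form a definable bijection.
\<close>

lemma cantor_bernstein:
  assumes "emb X Y" "emb Y X" shows "equip X Y"
proof -
  from assms(1) obtain f where f: "fun_definable f" "inj_on f (el X)" "f ` el X \<subseteq> el Y"
    unfolding emb_def by blast
  from assms(2) obtain g where g: "fun_definable g" "inj_on g (el Y)" "g ` el Y \<subseteq> el X"
    unfolding emb_def by blast
  \<comment> \<open>The bound \<open>y\<close> names the value \<open>f x'\<close>, which is not a
    term; this keeps \<open>closed\<close> definable.\<close>
  define closed where "closed S \<longleftrightarrow> (\<forall>x\<in>el X. (\<forall>y\<in>el Y. x \<noteq> g y) \<or>
    (\<exists>x'\<in>el S. \<exists>y. y = f x' \<and> x = g y) \<longrightarrow> x \<in> el S)" for S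
  have dc: "definable (\<lambda>e. closed (e 0))" unfolding closed_def
    by (intro definable_fun_eq[OF f(1)] definable_fun_eq[OF g(1)] definable_intros)
  have "definable (\<lambda>e. \<forall>S. closed S \<longrightarrow> e 0 \<in> el S)"
    by (intro definable_subst1[OF dc] definable_intros)
  then obtain A where A: "el A = {x \<in> el X. \<forall>S. closed S \<longrightarrow> x \<in> el S}"
    using sep[where P = "\<lambda>x. \<forall>S. closed S \<longrightarrow> x \<in> el S"] by blast
  have A1: "x \<in> el A" if "x \<in> el X" "\<forall>y\<in>el Y. x \<noteq> g y" for x
    using that unfolding A closed_def by blast
  have A2: "g (f x) \<in> el A" if "x \<in> el A" for x
  proof -
    have "g (f x) \<in> el X" using that f(3) g(3) unfolding A by blast
    moreover have "g (f x) \<in> el S" if S: "closed S" for S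
    proof -
      have "x \<in> el S" using S \<open>x \<in> el A\<close> unfolding A by blast
      with S \<open>g (f x) \<in> el X\<close> show ?thesis unfolding closed_def by metis
    qed
    ultimately show ?thesis unfolding A by blast
  qed
  \<comment> \<open>By minimality of \<open>A\<close>: the points of \<open>A\<close> with such an
    origin already form a closed set.\<close>
  have A3: "(\<forall>y\<in>el Y. x \<noteq> g y) \<or> (\<exists>x'\<in>el A. x = g (f x'))" if x: "x \<in> el A" for x
  proof -
    let ?P = "\<lambda>x. (\<forall>y\<in>el Y. x \<noteq> g y) \<or> (\<exists>x'\<in>el A. \<exists>y. y = f x' \<and> x = g y)"
    have "definable (\<lambda>e. ?P (e 0))"
      by (intro definable_fun_eq[OF f(1)] definable_fun_eq[OF g(1)] definable_intros)
    then obtain S where S: "el S = {x \<in> el A. ?P x}" using sep[where P = ?P] by blast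
    have "closed S" unfolding closed_def
    proof (intro ballI impI)
      fix z assume z: "z \<in> el X"
        "(\<forall>y\<in>el Y. z \<noteq> g y) \<or> (\<exists>x'\<in>el S. \<exists>y. y = f x' \<and> z = g y)"
      then have "?P z" using S by auto
      moreover from this z(1) have "z \<in> el A" using A1 A2 by blast
      ultimately show "z \<in> el S" unfolding S by simp
    qed
    with x have "x \<in> el S" unfolding A by blast
    then show ?thesis unfolding S by blast
  qed
  define k where "k x = (if x \<in> el A then f x
    else if x \<in> el X then inv_into (el Y) g x else x)" for x
  have kB: "k x \<in> el Y \<and> g (k x) = x" if x: "x \<in> el X" "x \<notin> el A" for x
  proof -
    have "x \<in> g ` el Y" using A1 x by blast
    then show ?thesis using x by (simp add: k_def inv_into_into f_inv_into_f)
  qed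
  have "definable (\<lambda>e. (e 0 \<in> el A \<and> e 1 = f (e 0)) \<or> (e 0 \<notin> el A \<and>
      ((e 0 \<in> el X \<and> e 1 \<in> el Y \<and> e 0 = g (e 1)) \<or> (e 0 \<notin> el X \<and> e 1 = e 0))))"
    by (intro definable_fun_eq[OF f(1)] definable_fun_eq[OF g(1)] definable_intros)
  then have "fun_definable k"
  proof (rule fun_definableI[where R = "\<lambda>x y. (x \<in> el A \<and> y = f x) \<or> (x \<notin> el A \<and>
      ((x \<in> el X \<and> y \<in> el Y \<and> x = g y) \<or> (x \<notin> el X \<and> y = x)))"])
    fix x y
    have "y = k x" if "x \<in> el X" "x \<notin> el A" "y \<in> el Y" "x = g y"
      using kB[OF that(1,2)] that(3,4) g(2) by (metis inj_onD)
    then show "y = k x \<longleftrightarrow> (x \<in> el A \<and> y = f x) \<or> (x \<notin> el A \<and>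
      ((x \<in> el X \<and> y \<in> el Y \<and> x = g y) \<or> (x \<notin> el X \<and> y = x)))"
      using kB[of x] by (auto simp: k_def)
  qed
  moreover have "inj_on k (el X)"
  proof -
    \<comment> \<open>Equality would give \<open>g (f x) = z\<close> by \<open>kB\<close>, and
      \<open>A2\<close> would put \<open>z\<close> into \<open>A\<close>.\<close>
    have "f x \<noteq> k z" if "x \<in> el A" "z \<in> el X" "z \<notin> el A" for x z
      using A2 kB that by metis
    then show ?thesis
      using f(2) kB unfolding inj_on_def by (metis A k_def mem_Collect_eq)
  qed
  moreover have "k ` el X = el Y"
  proof
    show "k ` el X \<subseteq> el Y"
    proof
      fix y assume "y \<in> k ` el X"
      then obtain x where "x \<in> el X" "y = k x" by blast
      then show "y \<in> el Y" using kB f(3) by (cases "x \<in> el A") (auto simp: k_def)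
    qed
    show "el Y \<subseteq> k ` el X"
    proof
      fix y assume y: "y \<in> el Y"
      then have gy: "g y \<in> el X" using g(3) by blast
      show "y \<in> k ` el X"
      proof (cases "g y \<in> el A")
        case True
        with A3 y obtain x' where x': "x' \<in> el A" "g y = g (f x')" by metis
        then have "x' \<in> el X" using A by blast
        then have "f x' \<in> el Y" using f(3) by blast
        with x' y g(2) have "y = f x'" by (metis inj_onD)
        with x' \<open>x' \<in> el X\<close> show ?thesis by (auto simp: k_def)
      next
        case False
        with kB[OF gy] y g(2) have "k (g y) = y" by (metis inj_onD)
        with gy show ?thesis by force
      qed
    qed
  qed
  ultimately show ?thesis unfolding equip_def bij_betw_def by blast
qed

section \<open>The natural numbers of the model\<close>

definition zero :: 'a where
  "zero = (SOME x. el x = {})"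

definition suc :: "'a \<Rightarrow> 'a" where
  "suc x = (SOME y. el y = insert x (el x))"

definition om :: 'a where
  "om = (SOME w. omega w)"

lemma el_zero: "el zero = {}"
proof -
  have "\<exists>x. el x = {}" using succ_closed_ex unfolding succ_closed_def by blast
  then show ?thesis unfolding zero_def by (rule someI_ex)
qed

lemma el_suc: "el (suc x) = insert x (el x)"
proof -
  obtain s where s: "el s = {x}" using upair_ex[of x x] by auto
  obtain p where p: "el p = {x, s}" using upair_ex by blast
  have "\<exists>y. el y = insert x (el x)" using union_ex[of p] p s by auto
  then show ?thesis unfolding suc_def by (rule someI_ex)
qed

lemma fun_definable_suc: "fun_definable suc"
proof (rule fun_definableI)
  show "definable (\<lambda>e. \<forall>z. z \<in> el (e 1) \<longleftrightarrow> z = e 0 \<or> z \<in> el (e 0))"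
    by (intro definable_intros)
  show "y = suc x \<longleftrightarrow> (\<forall>z. z \<in> el y \<longleftrightarrow> z = x \<or> z \<in> el x)" for x y
  proof
    assume "\<forall>z. z \<in> el y \<longleftrightarrow> z = x \<or> z \<in> el x"
    then show "y = suc x" by (intro ext) (auto simp: el_suc)
  qed (auto simp: el_suc)
qed

lemma succ_closed_iff:
  "succ_closed w \<longleftrightarrow> zero \<in> el w \<and> (\<forall>x\<in>el w. suc x \<in> el w)"
  unfolding succ_closed_def using el_zero el_suc ext by metis

lemma definable_succ_closed:
  assumes "trm a" shows "definable (\<lambda>e. succ_closed (a e))"
proof (rule definable_subst1[OF _ assms])
  have "succ_closed w \<longleftrightarrow> zero \<in> el w \<and> (\<forall>x\<in>el w. \<forall>y. y = suc x \<longrightarrow> y \<in> el w)" for w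
    unfolding succ_closed_iff by blast
  then show "definable (\<lambda>e. succ_closed (e 0))"
    by (simp only:) (intro definable_fun_eq[OF fun_definable_suc] definable_intros)
qed

text \<open>Inside any one successor-closed set, separation forms the intersection of all of
  them.\<close>

lemma omega_om: "omega om"
proof -
  obtain v where v: "succ_closed v" using succ_closed_ex by blast
  have "definable (\<lambda>e. \<forall>u. succ_closed u \<longrightarrow> e 0 \<in> el u)"
    by (intro definable_succ_closed definable_intros)
  then obtain w where w: "el w = {x \<in> el v. \<forall>u. succ_closed u \<longrightarrow> x \<in> el u}"
    using sep[where P = "\<lambda>x. \<forall>u. succ_closed u \<longrightarrow> x \<in> el u"] by blast
  have "omega w" using v unfolding omega_def succ_closed_iff w by blast
  then show ?thesis unfolding om_def by (rule someI)
qed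

lemma omega_iff: "omega w \<longleftrightarrow> w = om"
  using omega_om ext unfolding omega_def by (metis subset_antisym)

lemma zero_in_om: "zero \<in> el om"
  using omega_om unfolding omega_def succ_closed_iff by blast

lemma suc_in_om: "x \<in> el om \<Longrightarrow> suc x \<in> el om"
  using omega_om unfolding omega_def succ_closed_iff by blast

lemma om_induct:
  assumes "n \<in> el om" and "definable (\<lambda>e. P (e 0))"
    and "P zero" and "\<And>n. n \<in> el om \<Longrightarrow> P n \<Longrightarrow> P (suc n)"
  shows "P n"
proof -
  obtain w where w: "el w = {n \<in> el om. P n}" using sep[OF assms(2)] by blast
  have "succ_closed w" unfolding succ_closed_iff w using assms zero_in_om suc_in_om by blast
  with assms(1) show ?thesis using omega_om w unfolding omega_def by blast
qed

lemma suc_neq_zero: "suc x \<noteq> zero"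
  using el_suc el_zero by (metis empty_iff insertI1)

text \<open>Otherwise each of the two would be an element of the other, which foundation, applied to
  their unordered pair, excludes.\<close>

lemma suc_inj: "suc x = suc y \<Longrightarrow> x = y"
proof (rule ccontr)
  assume "suc x = suc y" "x \<noteq> y"
  then have "x \<in> el y" "y \<in> el x" using el_suc by (metis insert_iff)+
  moreover obtain u where "el u = {x, y}" using upair_ex by blast
  ultimately show False using foundation[of u] by auto
qed

text \<open>
  Recursion along \<open>om\<close> without a recursion theorem: \<open>R\<close> is the least relation that relates
  zero to \<open>a\<close> and is closed under \<open>(n, x) \<mapsto> (suc n, g x)\<close>.
\<close>

lemma om_emb_of_dedekind:
  assumes g: "fun_definable g" "inj_on g (el V)" "g ` el V \<subseteq> el V"
    and a: "a \<in> el V" "a \<notin> g ` el V"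
  shows "emb om V"
proof -
  define closed where "closed S \<longleftrightarrow> mapsto S zero a \<and> (\<forall>n\<in>el om. \<forall>x\<in>el V. mapsto S n x \<longrightarrow>
    (\<forall>m y. m = suc n \<and> y = g x \<longrightarrow> mapsto S m y))" for S
  define R where "R n x \<longleftrightarrow> n \<in> el om \<and> x \<in> el V \<and> (\<forall>S. closed S \<longrightarrow> mapsto S n x)" for n x
  have dc: "definable (\<lambda>e. closed (e 0))" unfolding closed_def
    by (intro definable_fun_eq[OF g(1)] definable_fun_eq[OF fun_definable_suc]
        definable_mapsto definable_intros)
  have dR: "definable (\<lambda>e. R (e 0) (e 1))" unfolding R_def
    by (intro definable_subst1[OF dc] definable_mapsto definable_intros)
  have R0: "R zero a" using a zero_in_om unfolding R_def closed_def by blast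
  have RS: "R (suc n) (g x)" if "R n x" for n x
  proof -
    have "suc n \<in> el om" "g x \<in> el V" using that suc_in_om g(3) unfolding R_def by auto
    moreover have "mapsto S (suc n) (g x)" if S: "closed S" for S
    proof -
      have "n \<in> el om" "x \<in> el V" "mapsto S n x" using S \<open>R n x\<close> unfolding R_def by auto
      with S show ?thesis unfolding closed_def by metis
    qed
    ultimately show ?thesis unfolding R_def by blast
  qed
  \<comment> \<open>By minimality of \<open>R\<close>: its pairs with an origin of this kind already
    form a closed relation.\<close>
  have inv: "(n = zero \<and> x = a) \<or> (\<exists>m y. R m y \<and> n = suc m \<and> x = g y)" if R: "R n x" for n x
  proof -
    let ?Q = "\<lambda>n x. R n x \<and> ((n = zero \<and> x = a) \<or> (\<exists>m y. R m y \<and> n = suc m \<and> x = g y))"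
    have dQ: "definable (\<lambda>e. ?Q (e 0) (e 1))"
      by (intro definable_fun_eq[OF g(1)] definable_fun_eq[OF fun_definable_suc]
          definable_subst2[OF dR] definable_intros)
    obtain S where S: "\<And>n x. mapsto S n x \<longleftrightarrow> n \<in> el om \<and> x \<in> el V \<and> ?Q n x"
      by (rule relation_ex[of ?Q om V, OF dQ]) (rule that)
    have "closed S" unfolding closed_def
    proof (intro conjI ballI impI allI)
      show "mapsto S zero a" by (simp add: S R0 a(1) zero_in_om)
      fix n x m y
      assume *: "n \<in> el om" "x \<in> el V" "mapsto S n x" "m = suc n \<and> y = g x"
      then have "R n x" by (simp add: S)
      moreover have "suc n \<in> el om" "g x \<in> el V" using * suc_in_om g(3) by auto
      ultimately show "mapsto S m y" using * RS by (auto simp: S)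
    qed
    with R have "mapsto S n x" unfolding R_def by blast
    then show ?thesis unfolding S by blast
  qed
  have ex: "\<exists>!x. R n x" if "n \<in> el om" for n
    using that
  proof (rule om_induct[where P = "\<lambda>n. \<exists>!x. R n x"])
    show "definable (\<lambda>e. \<exists>!x. R (e 0) x)" unfolding Ex1_def
      by (intro definable_subst2[OF dR] definable_intros)
    show "\<exists>!x. R zero x" using R0 inv suc_neq_zero by metis
    show "\<exists>!x. R (suc n) x" if "n \<in> el om" "\<exists>!x. R n x" for n
      using that RS inv suc_neq_zero suc_inj by metis
  qed
  \<comment> \<open>Here it matters that \<open>a\<close> is outside the image of \<open>g\<close>:
    only zero can be related to \<open>a\<close>. The induction step cancels one application of the
    injective \<open>g\<close>.\<close>
  have inj: "\<forall>x m. R n x \<and> R m x \<longrightarrow> n = m" if "n \<in> el om" for n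
    using that
  proof (rule om_induct[where P = "\<lambda>n. \<forall>x m. R n x \<and> R m x \<longrightarrow> n = m"])
    show "definable (\<lambda>e. \<forall>x m. R (e 0) x \<and> R m x \<longrightarrow> e 0 = m)"
      by (intro definable_subst2[OF dR] definable_intros)
    have notin: "g x \<noteq> a" if "R n x" for n x using that a(2) unfolding R_def by blast
    show "\<forall>x m. R zero x \<and> R m x \<longrightarrow> zero = m" using inv notin suc_neq_zero by metis
    show "\<forall>x m. R (suc n) x \<and> R m x \<longrightarrow> suc n = m"
      if IH: "\<forall>x m. R n x \<and> R m x \<longrightarrow> n = m" for n
    proof (intro allI impI, elim conjE)
      fix x m assume *: "R (suc n) x" "R m x"
      from inv[OF *(1)] obtain y where y: "R n y" "x = g y" using suc_neq_zero suc_inj by metis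
      with inv[OF *(2)] obtain m' y' where y': "R m' y'" "m = suc m'" "x = g y'"
        using notin by metis
      have "y = y'" using y y' g(2) unfolding R_def by (metis inj_onD)
      with IH y y' show "suc n = m" by blast
    qed
  qed
  define h where "h n = (if n \<in> el om then THE x. R n x else n)" for n
  have h: "R n (h n)" if "n \<in> el om" for n using theI'[OF ex[OF that]] that by (simp add: h_def)
  have "definable (\<lambda>e. R (e 0) (e 1) \<or> (e 0 \<notin> el om \<and> e 1 = e 0))"
    by (intro definable_subst2[OF dR] definable_intros)
  then have "fun_definable h"
  proof (rule fun_definableI[where R = "\<lambda>n x. R n x \<or> (n \<notin> el om \<and> x = n)"])
    show "x = h n \<longleftrightarrow> R n x \<or> (n \<notin> el om \<and> x = n)" for n x
    proof (cases "n \<in> el om")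
      case True
      then show ?thesis using h ex by metis
    qed (auto simp: h_def R_def)
  qed
  moreover have "inj_on h (el om)" using h inj unfolding inj_on_def by metis
  moreover have "h ` el om \<subseteq> el V" using h unfolding R_def by blast
  ultimately show ?thesis unfolding emb_def by blast
qed

text \<open>The inverse bijection maps \<open>V\<close> into itself, onto \<open>X\<close>, and
  misses \<open>a\<close>; thus \<open>V\<close> is Dedekind-infinite.\<close>

lemma om_emb_of_equip_proper:
  assumes "equip X V" "el X \<subseteq> el V" "a \<in> el V" "a \<notin> el X" shows "emb om V"
proof -
  from equip_sym[OF assms(1)] obtain g where "fun_definable g" "inj_on g (el V)" "g ` el V = el X"
    unfolding equip_def bij_betw_def by blast
  with assms show ?thesis by (intro om_emb_of_dedekind[of g V a]) auto
qed

text \<open>Serves to see that small independent sets are finite and small cliques countable; the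
  case \<open>a = b\<close> covers at most one element.\<close>

lemma two_elements:
  assumes "el I \<subseteq> {a, b}" shows "emb I om" "\<not> emb om I"
proof -
  define h where "h x = (if x = a then zero else suc zero)" for x
  have "definable (\<lambda>e. (e 0 = a \<and> e 1 = zero) \<or> (e 0 \<noteq> a \<and> e 1 = suc zero))"
    by (intro definable_intros)
  then have "fun_definable h"
    by (rule fun_definableI[where R = "\<lambda>x y. (x = a \<and> y = zero) \<or> (x \<noteq> a \<and> y = suc zero)"])
      (auto simp: h_def)
  moreover have "inj_on h (el I)"
    using assms suc_neq_zero[of zero] by (auto simp: inj_on_def h_def split: if_splits)
  moreover have "h ` el I \<subseteq> el om" using zero_in_om suc_in_om by (auto simp: h_def)
  ultimately show "emb I om" unfolding emb_def by blast
  show "\<not> emb om I"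
  proof
    assume "emb om I"
    then obtain k where k: "inj_on k (el om)" "k ` el om \<subseteq> {a, b}"
      using assms unfolding emb_def by blast
    \<comment> \<open>Three distinct numbers cannot be sent injectively to two points.\<close>
    let ?A = "{zero, suc zero, suc (suc zero)}"
    have "?A \<subseteq> el om" using zero_in_om suc_in_om by blast
    then have "inj_on k ?A" "k ` ?A \<subseteq> {a, b}"
      using k by (meson inj_on_subset image_mono order_trans)+
    then have "card ?A \<le> card {a, b}" by (rule card_inj_on_le) simp
    moreover have "card ?A = 3"
      using suc_neq_zero[of zero] suc_neq_zero[of "suc zero"] suc_inj[of zero "suc zero"]
      by (auto simp: card_insert_if)
    moreover have "card {a, b} \<le> 2" by (simp add: card_insert_if)
    ultimately show False by linarith
  qed
qed

section \<open>The cardinality conditions in a model\<close>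

definition uncountable :: "'a \<Rightarrow> bool" where
  "uncountable X \<longleftrightarrow> \<not> emb X om"

text \<open>The literal reading of \<open>nless_aleph0\<close>, where strictly less means embeddable
  but not equinumerous.\<close>

definition infinite_set :: "'a \<Rightarrow> bool" where
  "infinite_set X \<longleftrightarrow> \<not> (emb X om \<and> \<not> equip X om)"

definition above_aleph0 :: "'a \<Rightarrow> bool" where
  "above_aleph0 X \<longleftrightarrow> emb om X \<and> \<not> equip om X"

lemma ev_card_le [simp]: "X < d \<Longrightarrow> Y < d \<Longrightarrow> ev (card_le X Y) d v \<longleftrightarrow> emb (v X) (v Y)"
  by (simp add: card_le_def emb_iff)

lemma ev_card_eq [simp]: "X < d \<Longrightarrow> Y < d \<Longrightarrow> ev (card_eq X Y) d v \<longleftrightarrow> equip (v X) (v Y)"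
  by (simp add: card_eq_def equip_iff)

lemma ev_nle [simp]: "X < d \<Longrightarrow> ev (nle_aleph0 X) d v \<longleftrightarrow> uncountable (v X)"
  by (simp add: nle_aleph0_def uncountable_def omega_iff)

lemma ev_nless [simp]: "X < d \<Longrightarrow> ev (nless_aleph0 X) d v \<longleftrightarrow> infinite_set (v X)"
  by (simp add: nless_aleph0_def infinite_set_def omega_iff card_less_def)

lemma ev_ge [simp]: "X < d \<Longrightarrow> ev (ge_aleph0 X) d v \<longleftrightarrow> emb om (v X)"
  by (simp add: ge_aleph0_def omega_iff)

lemma ev_gt [simp]: "X < d \<Longrightarrow> ev (gt_aleph0 X) d v \<longleftrightarrow> above_aleph0 (v X)"
  by (simp add: gt_aleph0_def above_aleph0_def omega_iff card_less_def)

text \<open>With an embedding in the other direction as well, Cantor-Bernstein gives equinumerosity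
  with omega, so the set is not strictly below it.\<close>

lemma infinite_of_ge: "emb om X \<Longrightarrow> infinite_set X"
  unfolding infinite_set_def using cantor_bernstein by blast

lemma uncountable_of_above: "above_aleph0 X \<Longrightarrow> uncountable X"
  unfolding above_aleph0_def uncountable_def using cantor_bernstein by blast

lemma not_infinite_two: "el I \<subseteq> {a, b} \<Longrightarrow> \<not> infinite_set I"
  unfolding infinite_set_def using two_elements[of I a b] equip_emb equip_sym by blast

definition uncountables_ge :: bool where
  "uncountables_ge \<longleftrightarrow> (\<forall>X. uncountable X \<longrightarrow> emb om X)"

lemma ge_of_infinite: "uncountables_ge \<Longrightarrow> infinite_set X \<Longrightarrow> emb om X"
  unfolding uncountables_ge_def infinite_set_def uncountable_def
  using equip_emb equip_sym by blast

lemma above_of_uncountable: "uncountables_ge \<Longrightarrow> uncountable X \<Longrightarrow> above_aleph0 X"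
  unfolding uncountables_ge_def above_aleph0_def uncountable_def
  using equip_emb equip_sym by blast

section \<open>Comparison of the EDM statements\<close>

lemma edm_mono:
  assumes "edm U B C" "\<And>I. B I \<Longrightarrow> B' I" "\<And>V V'. U V \<Longrightarrow> C V V' \<Longrightarrow> C' V V'"
  shows "edm U B' C'"
  using assms unfolding edm_def by metis

text \<open>The condition on \<open>C\<close> covers two kinds of clique: one equinumerous with
  \<open>V\<close>, where the omitted vertex counts, and one that already contains a copy of
  omega.\<close>

lemma uncountables_ge_of_infinite:
  assumes edm: "edm uncountable infinite_set C"
    and C: "\<And>V V'. C V V' \<Longrightarrow> equip V' V \<or> emb om V'"
  shows uncountables_ge
  unfolding uncountables_ge_def
proof (intro allI impI)
  fix V assume V: "uncountable V"
  have "\<exists>a\<in>el V. \<exists>b\<in>el V. a \<noteq> b"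
  proof (rule ccontr)
    assume "\<not> ?thesis"
    then have "\<exists>a. el V \<subseteq> {a, a}" by blast
    with V two_elements(1) show False unfolding uncountable_def by blast
  qed
  then obtain a b where ab: "a \<in> el V" "b \<in> el V" "a \<noteq> b" by blast
  obtain Q where Q: "el Q = {z. el z \<subseteq> el V}" using pow_ex by blast
  obtain c where c: "el c = {a, b}" using upair_ex by blast
  \<comment> \<open>Membership is spelled out to fit the definability rules; the removed edge
    \<open>c\<close> enters as a parameter.\<close>
  let ?P = "\<lambda>e. e \<noteq> c \<and> (\<exists>x\<in>el V. \<exists>y\<in>el V. x \<noteq> y \<and> (\<forall>z. z \<in> el e \<longleftrightarrow> z = x \<or> z = y))"
  have "definable (\<lambda>e. ?P (e 0))" by (intro definable_intros)
  then obtain E where "el E = {e \<in> el Q. ?P e}" using sep[where P = ?P] by blast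
  moreover have "?P e \<longleftrightarrow> e \<noteq> c \<and> (\<exists>x\<in>el V. \<exists>y\<in>el V. x \<noteq> y \<and> el e = {x, y})" for e
    by (simp add: set_eq_iff)
  ultimately have E: "el E = {e \<in> el Q. e \<noteq> c \<and> (\<exists>x\<in>el V. \<exists>y\<in>el V. x \<noteq> y \<and> el e = {x, y})}"
    by simp
  have graph: "graph V E" unfolding graph_def E by blast
  have adj: "adj E x y \<longleftrightarrow> {x, y} \<noteq> {a, b}" if xy: "x \<in> el V" "y \<in> el V" "x \<noteq> y" for x y
  proof -
    obtain e where e: "el e = {x, y}" using upair_ex by blast
    have "adj E x y \<longleftrightarrow> e \<in> el E" unfolding adj_def using e ext by metis
    also have "\<dots> \<longleftrightarrow> e \<noteq> c" unfolding E Q using e xy by auto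
    also have "\<dots> \<longleftrightarrow> {x, y} \<noteq> {a, b}" using e c ext by metis
    finally show ?thesis .
  qed
  have "\<not> infinite_set I" if I: "independent V E I" for I
  proof -
    \<comment> \<open>Distinct vertices are nonadjacent only if they are the ends of the removed
      edge.\<close>
    have *: "{x, y} = {a, b}" if "x \<in> el I" "y \<in> el I" "x \<noteq> y" for x y
      using I adj that unfolding independent_def by blast
    have "\<exists>a b. el I \<subseteq> {a, b}"
    proof (cases "\<exists>x\<in>el I. \<exists>y\<in>el I. x \<noteq> y")
      case True
      then have "el I \<subseteq> {a, b}" using * by blast
      then show ?thesis by blast
    qed blast
    then show ?thesis using not_infinite_two by blast
  qed
  with edm graph V obtain V' where V': "clique_in V E V'" "C V V'" unfolding edm_def by blast
  then have sub: "el V' \<subseteq> el V" unfolding clique_in_def by blast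
  have "\<not> adj E a b" using adj ab by blast
  then have "a \<notin> el V' \<or> b \<notin> el V'"
    using V'(1) ab(3) unfolding clique_in_def adj_def by blast
  with C[OF V'(2)] show "emb om V"
    using om_emb_of_equip_proper[of V'] ab sub emb_trans emb_subset by blast
qed

text \<open>Without edges a clique has at most one vertex and is countable, so the independent
  alternative holds and yields a copy of omega inside \<open>V\<close>. The edge set is
  \<open>zero\<close>.\<close>

lemma uncountables_ge_of_ge:
  assumes edm: "edm uncountable (emb om) (\<lambda>V. uncountable)"
  shows uncountables_ge
  unfolding uncountables_ge_def
proof (intro allI impI)
  fix V assume V: "uncountable V"
  have "graph V zero" by (simp add: graph_def el_zero)
  moreover have "\<not> uncountable V'" if V': "clique_in V zero V'" for V'
  proof -
    have "x = y" if "x \<in> el V'" "y \<in> el V'" for x y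
      using V' that unfolding clique_in_def adj_def by (auto simp: el_zero)
    then have "\<exists>a. el V' \<subseteq> {a, a}" by blast
    then show ?thesis using two_elements(1) unfolding uncountable_def by blast
  qed
  ultimately obtain I where "independent V zero I" "emb om I"
    using edm V unfolding edm_def by blast
  then show "emb om V" unfolding independent_def using emb_trans emb_subset by blast
qed

lemma edm_infinite_eq_iff:
  "edm uncountable infinite_set (\<lambda>V V'. equip V' V) \<longleftrightarrow>
   edm uncountable (emb om) (\<lambda>V V'. equip V' V)"
proof
  assume *: "edm uncountable infinite_set (\<lambda>V V'. equip V' V)"
  then have uncountables_ge by (rule uncountables_ge_of_infinite) blast
  then show "edm uncountable (emb om) (\<lambda>V V'. equip V' V)"
    using ge_of_infinite by (intro edm_mono[OF *]) auto
next
  assume *: "edm uncountable (emb om) (\<lambda>V V'. equip V' V)"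
  show "edm uncountable infinite_set (\<lambda>V V'. equip V' V)"
    using infinite_of_ge by (intro edm_mono[OF *]) auto
qed

lemma edm_ge_uncountable_iff_above:
  "edm uncountable (emb om) (\<lambda>V. uncountable) \<longleftrightarrow> edm uncountable (emb om) (\<lambda>V. above_aleph0)"
proof
  assume *: "edm uncountable (emb om) (\<lambda>V. uncountable)"
  then have uncountables_ge by (rule uncountables_ge_of_ge)
  then show "edm uncountable (emb om) (\<lambda>V. above_aleph0)"
    using above_of_uncountable by (intro edm_mono[OF *]) auto
next
  assume *: "edm uncountable (emb om) (\<lambda>V. above_aleph0)"
  then show "edm uncountable (emb om) (\<lambda>V. uncountable)"
    using uncountable_of_above by (intro edm_mono[OF *]) auto
qed

lemma edm_ge_above_iff_infinite:
  "edm uncountable (emb om) (\<lambda>V. above_aleph0) \<longleftrightarrow>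
   edm uncountable infinite_set (\<lambda>V. above_aleph0)"
proof
  assume *: "edm uncountable (emb om) (\<lambda>V. above_aleph0)"
  then show "edm uncountable infinite_set (\<lambda>V. above_aleph0)"
    using infinite_of_ge by (intro edm_mono[OF *]) auto
next
  assume *: "edm uncountable infinite_set (\<lambda>V. above_aleph0)"
  then have uncountables_ge
    by (rule uncountables_ge_of_infinite) (simp add: above_aleph0_def)
  then show "edm uncountable (emb om) (\<lambda>V. above_aleph0)"
    using ge_of_infinite by (intro edm_mono[OF *]) auto
qed

lemma edm_infinite_eq_imp_above:
  assumes "edm uncountable infinite_set (\<lambda>V V'. equip V' V)"
  shows "edm uncountable infinite_set (\<lambda>V. above_aleph0)"
proof (rule edm_mono[OF assms])
  have ge: uncountables_ge using assms by (rule uncountables_ge_of_infinite) blast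
  \<comment> \<open>\<open>V\<close> embeds in \<open>V'\<close>, so an embedding of
    \<open>V'\<close> in omega would make \<open>V\<close> countable; this uses that
    \<open>edm_mono\<close> provides the uncountability of \<open>V\<close>.\<close>
  show "above_aleph0 V'" if "uncountable V" "equip V' V" for V V'
    using that equip_emb equip_sym emb_trans
    by (intro above_of_uncountable[OF ge]) (metis uncountable_def)
qed

lemma edm_infinite_above_imp_uncountable:
  "edm uncountable infinite_set (\<lambda>V. above_aleph0) \<Longrightarrow>
   edm uncountable infinite_set (\<lambda>V. uncountable)"
  by (erule edm_mono) (auto simp: uncountable_of_above)

end

section \<open>From provability to models\<close>

text \<open>Subtraction truncates, so below at least one quantifier every index is in range whatever
  the level; closedness can be checked without tracking levels.\<close>

lemma fv_feq [simp]: "fv_below (Suc d) ((x \<^bold>= y) (Suc d))"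
  by (simp add: feq_def less_Suc_eq_le)

lemma fv_fmem [simp]: "fv_below (Suc d) ((x \<^bold>\<in> y) (Suc d))"
  by (simp add: fmem_def less_Suc_eq_le)

lemma fv_fimp [simp]: "fv_below n ((p \<^bold>\<longrightarrow> q) d) \<longleftrightarrow> fv_below n (p d) \<and> fv_below n (q d)"
  by (simp add: fimp_def)

lemma fv_fnot [simp]: "fv_below n ((\<^bold>\<not> p) d) \<longleftrightarrow> fv_below n (p d)"
  by (simp add: fnot_def)

lemma fv_fand [simp]: "fv_below n ((p \<^bold>\<and> q) d) \<longleftrightarrow> fv_below n (p d) \<and> fv_below n (q d)"
  by (simp add: fand_def)

lemma fv_f_or [simp]: "fv_below n ((p \<^bold>\<or> q) d) \<longleftrightarrow> fv_below n (p d) \<and> fv_below n (q d)"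
  by (simp add: f_or_def)

lemma fv_fiff [simp]: "fv_below n ((p \<^bold>\<longleftrightarrow> q) d) \<longleftrightarrow> fv_below n (p d) \<and> fv_below n (q d)"
  by (auto simp: fiff_def)

lemma fv_fall [simp]: "fv_below d (fall P d) \<longleftrightarrow> fv_below (Suc d) (P d (Suc d))"
  by (simp add: fall_def)

lemma fv_fex [simp]: "fv_below d (fex P d) \<longleftrightarrow> fv_below (Suc d) (P d (Suc d))"
  by (simp add: fex_def)

lemma fv_holds [simp]: "fv_below (Suc d) (holds \<phi> r (Suc d))"
  unfolding holds_def by (rule fv_below_ren) simp

lemma fv_univ_closure [simp]: "fv_below 0 (univ_closure k p) \<longleftrightarrow> fv_below k (p k)"
proof -
  have "fv_below n ((All ^^ k) \<phi>) \<longleftrightarrow> fv_below (n + k) \<phi>" for n \<phi>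
    by (induction k arbitrary: n) auto
  then show ?thesis by (simp add: univ_closure_def)
qed

lemmas vocabulary_defs = is_subset_def is_empty_def is_succ_def is_inductive_def is_upair_def
  is_opair_def maps_def is_function_def is_injection_def is_bijection_def card_le_def card_eq_def
  card_less_def is_omega_def nless_aleph0_def ge_aleph0_def nle_aleph0_def gt_aleph0_def
  is_graph_def adjacent_def is_independent_def is_subgraph_def is_clique_def EDM_def
  C_nle_def C_gt_def C_eqV_def

lemma ZF_closed: "\<chi> \<in> ZF \<Longrightarrow> fv_below 0 \<chi>"
  unfolding ZF_def
  by (auto simp: vocabulary_defs extensionality_def foundation_def pairing_def union_axiom_def
      power_set_def infinity_def separation_def replacement_def Let_def)

text \<open>The singleton map is injective and misses the empty set, which is impossible for a
  self-map of a finite set.\<close>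

lemma infinite_model:
  assumes "\<And>\<chi> e. \<chi> \<in> ZF \<Longrightarrow> sat D M e \<chi>" shows "infinite D"
proof
  assume fin: "finite D"
  have "sat D M undefined (pairing 0)" "sat D M undefined (infinity 0)"
    using assms by (auto simp: ZF_def)
  then have pair2: "\<forall>x\<in>D. \<forall>y\<in>D. \<exists>u\<in>D. \<forall>z\<in>D. M z u \<longleftrightarrow> z = x \<or> z = y"
    and empty: "\<exists>x\<in>D. \<forall>z\<in>D. \<not> M z x"
    by (auto simp: pairing_def infinity_def is_inductive_def is_empty_def
        sat_connectives feq_def fmem_def)
  from pair2 have pair: "\<forall>x\<in>D. \<exists>u\<in>D. \<forall>z\<in>D. M z u \<longleftrightarrow> z = x" by metis
  from pair obtain f where f: "\<And>x. x \<in> D \<Longrightarrow> f x \<in> D \<and> (\<forall>z\<in>D. M z (f x) \<longleftrightarrow> z = x)"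
    by metis
  then have "inj_on f D" "f ` D \<subseteq> D" by (auto simp: inj_on_def) metis
  then have "f ` D = D" using fin by (simp add: endo_inj_surj)
  with empty f show False by (metis imageE)
qed

context membership
begin

text \<open>Validity in all environments passes through each outer quantifier, so the parameters may
  be given any values \<open>v\<close>.\<close>

lemma sat_univ_closure:
  assumes "\<And>e. sat UNIV M e (univ_closure k p)" shows "ev p k v"
proof -
  have "(\<forall>e. sat UNIV M e ((All ^^ k) \<phi>)) \<longleftrightarrow> (\<forall>e. sat UNIV M e \<phi>)" for \<phi>
  proof (induction k)
    case (Suc k)
    have "(\<forall>e. sat UNIV M e (All \<psi>)) \<longleftrightarrow> (\<forall>e. sat UNIV M e \<psi>)" for \<psi>
    proof
      assume *: "\<forall>e. sat UNIV M e (All \<psi>)"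
      show "\<forall>e. sat UNIV M e \<psi>"
      proof
        fix e :: "nat \<Rightarrow> 'a"
        have "case_nat (e 0) (\<lambda>i. e (Suc i)) = e" by (auto simp: fun_eq_iff split: nat.split)
        with *[rule_format, of "\<lambda>i. e (Suc i)"] show "sat UNIV M e \<psi>" by (auto dest: spec[of _ "e 0"])
      qed
    qed simp
    with Suc show ?case by simp
  qed simp
  with assms show ?thesis unfolding univ_closure_def ev_def by blast
qed

lemma zf_model_of_ZF:
  assumes ZF: "\<And>\<chi> e. \<chi> \<in> ZF \<Longrightarrow> sat UNIV M e \<chi>" shows "zf_model M"
proof -
  have ev: "ev p 0 undefined" if "p 0 \<in> ZF" for p
    using ZF[OF that] by (simp add: ev_def)
  have "ev extensionality 0 undefined" "ev foundation 0 undefined" "ev pairing 0 undefined"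
    "ev union_axiom 0 undefined" "ev power_set 0 undefined" "ev infinity 0 undefined"
    by (rule ev, simp add: ZF_def)+
  note axs = this[unfolded extensionality_def foundation_def pairing_def union_axiom_def
      power_set_def infinity_def, simplified]
  have sep: "\<exists>b. el b = {x \<in> el a. P x}" if P: "definable (\<lambda>e. P (e 0))" for P a
  proof -
    from P obtain \<phi> t where t: "\<And>i. trm (t i)" and \<phi>: "\<And>e. P (e 0) \<longleftrightarrow> sat UNIV M (\<lambda>i. t i e) \<phi>"
      unfolding definable_def by blast
    \<comment> \<open>\<open>P\<close> depends only on the place 0, so it may be evaluated in the
      constant environment at \<open>x\<close>. Variables that read the environment become index 0;
      a variable with a fixed parameter becomes \<open>Suc i\<close>, the index of the separation
      parameter of level \<open>i\<close>, whose value is \<open>c i\<close>.\<close>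
    define r where "r i = (if \<exists>c. t i = (\<lambda>e. c) then Suc i else 0)" for i
    define c where "c i = t i undefined" for i
    define \<psi> where "\<psi> = ren r \<phi>"
    have t': "t i (\<lambda>j. x) = case_nat x c (r i)" for i x
    proof (cases "\<exists>c. t i = (\<lambda>e. c)")
      case True
      then show ?thesis by (auto simp: r_def c_def)
    next
      case False
      with t[of i] show ?thesis by (auto simp: r_def trm_def)
    qed
    have P': "P x \<longleftrightarrow> sat UNIV M (case_nat x c) \<psi>" for x
      using \<phi>[of "\<lambda>j. x"] by (simp add: \<psi>_def sat_ren t')
    obtain k where k: "fv_below k \<psi>" using fv_below_exists by blast
    then have k': "fv_below (Suc k) \<psi>" by (rule fv_below_mono) simp
    then have "univ_closure k (separation \<psi>) \<in> ZF" unfolding ZF_def by blast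
    then have "ev (separation \<psi>) k c" using ZF sat_univ_closure by blast
    moreover have "ev (holds \<psi> (case_nat (Suc (Suc k)) (\<lambda>i. i))) (Suc (Suc (Suc k)))
        (c(k := a, Suc k := b, Suc (Suc k) := x)) \<longleftrightarrow> P x" for a b x
    proof -
      have "ev (holds \<psi> (case_nat (Suc (Suc k)) (\<lambda>i. i))) (Suc (Suc (Suc k)))
          (c(k := a, Suc k := b, Suc (Suc k) := x)) \<longleftrightarrow>
        sat UNIV M (\<lambda>i. (c(k := a, Suc k := b, Suc (Suc k) := x))
          (case_nat (Suc (Suc k)) (\<lambda>i. i) i)) \<psi>"
        by (rule ev_holds[OF k']) (simp split: nat.split)
      \<comment> \<open>The updates concern levels from \<open>k\<close> on, whereas the parameters
        have levels below \<open>k\<close>.\<close>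
      also have "\<dots> \<longleftrightarrow> sat UNIV M (case_nat x c) \<psi>"
        by (rule sat_cong[OF k']) (auto split: nat.split)
      finally show ?thesis by (simp add: P')
    qed
    ultimately have "\<forall>a. \<exists>b. \<forall>x. x \<in> el b \<longleftrightarrow> x \<in> el a \<and> P x"
      unfolding separation_def by simp
    then show ?thesis by (simp add: set_eq_iff)
  qed
  show ?thesis
  proof
    show "\<exists>b. el b = {x \<in> el a. P x}" if "definable (\<lambda>e. P (e 0))" for P a
      using that by (rule sep)
    show "x = y" if "el x = el y" for x y
      using axs(1) that by blast
    show "\<exists>u. el u = {x, y}" for x y
      using axs(3) by (simp add: set_eq_iff)
    show "\<exists>u. el u = (\<Union>y\<in>el x. el y)" for x
      using axs(4) by (simp add: set_eq_iff Bex_def)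
    show "\<exists>u. el u = {z. el z \<subseteq> el x}" for x
      using axs(5) by (simp add: set_eq_iff)
    show "\<exists>y\<in>el x. el x \<inter> el y = {}" if "el x \<noteq> {}" for x
      using axs(2) that by blast
    show "\<exists>w. succ_closed w"
      using axs(6) by blast
  qed
qed

end

lemma ZF_provesI:
  assumes closed: "fv_below 0 (p 0)"
    and valid: "\<And>(M :: nat \<Rightarrow> nat \<Rightarrow> bool) v. zf_model M \<Longrightarrow> membership.ev M p 0 v"
  shows "ZF_proves p"
proof (rule ccontr)
  assume "\<not> ZF_proves p"
  then have "consistent (insert (Neg (p 0)) ZF)"
    unfolding ZF_proves_def consistent_def by (meson Classical)
  moreover have "fv_below 0 \<chi>" if "\<chi> \<in> insert (Neg (p 0)) ZF" for \<chi>
    using that closed ZF_closed by auto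
  ultimately have "\<exists>(D :: nat set) M. \<forall>\<chi>\<in>insert (Neg (p 0)) ZF. \<forall>e. sat D M e \<chi>"
    by (rule model_existence)
  then obtain D :: "nat set" and M
    where "\<forall>\<chi>\<in>insert (Neg (p 0)) ZF. \<forall>e. sat D M e \<chi>" by (elim exE)
  then have sat: "sat D M e \<chi>" if "\<chi> \<in> insert (Neg (p 0)) ZF" for e \<chi>
    using that by auto
  have "sat D M e \<chi>" if "\<chi> \<in> ZF" for e \<chi> using sat that by blast
  then have "infinite D" by (rule infinite_model)
  \<comment> \<open>\<open>zf_model\<close> quantifies over a whole type, so the infinite set
    \<open>D\<close> is renumbered by all naturals.\<close>
  then have b: "bij_betw (enumerate D) UNIV D" by (rule bij_enumerate)
  define N where "N x y = M (enumerate D x) (enumerate D y)" for x y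
  have N: "sat UNIV N e \<chi>" if "\<chi> \<in> insert (Neg (p 0)) ZF" for e \<chi>
    using sat_iso[OF b, of M e \<chi>] sat[OF that] by (simp add: N_def[abs_def])
  have "sat UNIV N e \<chi>" if "\<chi> \<in> ZF" for e \<chi> using N that by blast
  then have "zf_model N" by (rule membership.zf_model_of_ZF)
  then have "membership.ev N p 0 undefined" by (rule valid)
  with N[of "Neg (p 0)"] show False by (simp add: membership.ev_def)
qed

lemma EDM_closed [simp]:
  "fv_below 0 (EDM nless_aleph0 C_eqV 0)" "fv_below 0 (EDM ge_aleph0 C_eqV 0)"
  "fv_below 0 (EDM ge_aleph0 C_nle 0)" "fv_below 0 (EDM ge_aleph0 C_gt 0)"
  "fv_below 0 (EDM nless_aleph0 C_gt 0)" "fv_below 0 (EDM nless_aleph0 C_nle 0)"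
  by (simp_all add: vocabulary_defs)

section \<open>The EDM sentences evaluated in a model\<close>

context zf_model
begin

lemma ev_EDM_infinite_eq:
  "ev (EDM nless_aleph0 C_eqV) d v \<longleftrightarrow> edm uncountable infinite_set (\<lambda>V V'. equip V' V)"
  by (rule ev_EDM) (simp_all add: C_eqV_def)

lemma ev_EDM_ge_eq:
  "ev (EDM ge_aleph0 C_eqV) d v \<longleftrightarrow> edm uncountable (emb om) (\<lambda>V V'. equip V' V)"
  by (rule ev_EDM) (simp_all add: C_eqV_def)

lemma ev_EDM_ge_uncountable:
  "ev (EDM ge_aleph0 C_nle) d v \<longleftrightarrow> edm uncountable (emb om) (\<lambda>V. uncountable)"
  by (rule ev_EDM) (simp_all add: C_nle_def)

lemma ev_EDM_ge_above:
  "ev (EDM ge_aleph0 C_gt) d v \<longleftrightarrow> edm uncountable (emb om) (\<lambda>V. above_aleph0)"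
  by (rule ev_EDM) (simp_all add: C_gt_def)

lemma ev_EDM_infinite_above:
  "ev (EDM nless_aleph0 C_gt) d v \<longleftrightarrow> edm uncountable infinite_set (\<lambda>V. above_aleph0)"
  by (rule ev_EDM) (simp_all add: C_gt_def)

lemma ev_EDM_infinite_uncountable:
  "ev (EDM nless_aleph0 C_nle) d v \<longleftrightarrow> edm uncountable infinite_set (\<lambda>V. uncountable)"
  by (rule ev_EDM) (simp_all add: C_nle_def)

lemmas ev_EDMs = ev_EDM_infinite_eq ev_EDM_ge_eq ev_EDM_ge_uncountable ev_EDM_ge_above
  ev_EDM_infinite_above ev_EDM_infinite_uncountable

lemma ev_EDM_relations:
  "ev (EDM nless_aleph0 C_eqV \<^bold>\<longleftrightarrow> EDM ge_aleph0 C_eqV) 0 v"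
  "ev (EDM ge_aleph0 C_nle \<^bold>\<longleftrightarrow> EDM ge_aleph0 C_gt) 0 v"
  "ev (EDM ge_aleph0 C_nle \<^bold>\<longleftrightarrow> EDM nless_aleph0 C_gt) 0 v"
  "ev (EDM nless_aleph0 C_eqV \<^bold>\<longrightarrow> EDM nless_aleph0 C_gt) 0 v"
  "ev (EDM nless_aleph0 C_gt \<^bold>\<longrightarrow> EDM nless_aleph0 C_nle) 0 v"
  \<comment> \<open>Rewriting along the equivalences settles the first three claims. It also turns
    the premise of the fourth into its form with \<open>emb om\<close>, which the flipped
    equivalence undoes so that the implication lemma applies.\<close>
  by (simp_all add: ev_EDMs edm_infinite_eq_iff edm_ge_uncountable_iff_above
      edm_ge_above_iff_infinite)
    (simp_all add: edm_infinite_eq_imp_above edm_infinite_above_imp_uncountable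
      flip: edm_infinite_eq_iff)

end

theorem proposition4p4:
  "ZF_proves (EDM nless_aleph0 C_eqV \<^bold>\<longleftrightarrow> EDM ge_aleph0 C_eqV) \<and>
   ZF_proves (EDM ge_aleph0 C_nle \<^bold>\<longleftrightarrow> EDM ge_aleph0 C_gt) \<and>
   ZF_proves (EDM ge_aleph0 C_nle \<^bold>\<longleftrightarrow> EDM nless_aleph0 C_gt) \<and>
   ZF_proves (EDM nless_aleph0 C_eqV \<^bold>\<longrightarrow> EDM nless_aleph0 C_gt) \<and>
   ZF_proves (EDM nless_aleph0 C_gt \<^bold>\<longrightarrow> EDM nless_aleph0 C_nle)"
  by (intro conjI ZF_provesI zf_model.ev_EDM_relations) simp_all

end
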